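(* Let $n\geqslant1$ be an integer and $s\in(0,1)$. Suppose that $c\in L^\infty(B_1^+)$, and that $u\in H^s(\mathbb{R}^n)\cap C(B_1)$ is $x_1$-antisymmetric and satisfies $$\begin{cases}(-\Delta)^su+cu\geqslant0&\text{in }B_1^+,\\ u\geqslant0&\text{in }\mathbb{R}^n_+,\\ u>0&\text{in }B_1^+,\end{cases}$$ where the first inequality is understood in the weak sense. Then $$\liminf_{h\to0}\frac{u(he_1)}{h}>0 .$$
   Context: $B_1$ is the unit ball of $\mathbb{R}^n$ centered at $0$, $\mathbb{R}^n_+=\{x\in\mathbb{R}^n : x_1>0\}$, $B_1^+=B_1\cap\mathbb{R}^n_+$, and $e_1$ is the first coordinate unit vector. A function $u:\mathbb{R}^n\to\mathbb{R}$ is $x_1$-antisymmetric if $u(-x_1,x_2,\dots,x_n)=-u(x_1,x_2,\dots,x_n)$ for all $x\in\mathbb{R}^n$. $H^s(\mathbb{R}^n)$ is the space of $u\in L^2(\mathbb{R}^n)$ with $\iint_{\mathbb{R}^n\times\mathbb{R}^n}\frac{|u(x)-u(y)|^2}{|x-y|^{n+2s}}\,dx\,dy<\infty$; functions equal almost everywhere are identified. For a bounded open set $\Omega\subset\mathbb{R}^n$, $\mathcal{H}^s_0(\Omega)=\{v\in H^s(\mathbb{R}^n) : v=0\text{ in }\mathbb{R}^n\setminus\Omega\}$. For $c\in L^\infty(\Omega)$, a function $u\in H^s(\mathbb{R}^n)$ satisfies $(-\Delta)^su+cu\geqslant0$ in $\Omega$ in the weak sense if $$\frac{c_{n,s}}2\iint_{\mathbb{R}^n\times\mathbb{R}^n}\frac{(u(x)-u(y))(v(x)-v(y))}{|x-y|^{n+2s}}\,dx\,dy+\int_\Omega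 c(x)u(x)v(x)\,dx\geqslant0$$ for all $v\in\mathcal{H}^s_0(\Omega)$ with $v\geqslant0$, where $c_{n,s}=\frac{s4^s\Gamma(\frac{n+2s}{2})}{\Gamma(1-s)}>0$ is a normalisation constant. *)

theory Defs
  imports "HOL-Analysis.Analysis"
begin

text \<open>
  \<open>\<real>\<^sup>n\<close> is \<^typ>\<open>real ^ 'n\<close> with \<open>n = CARD('n)\<close>. A finite index type has no canonical first
  element, so the index \<open>k :: 'n\<close> of the coordinate called \<open>x\<^sub>1\<close> in the mathematics is an arbitrary
  parameter; \<open>e\<^sub>1\<close> is \<open>axis k 1\<close>.

  Functions are representatives of their a.e.-classes: measurability and integrals refer to the
  (complete) Lebesgue measure, and conditions on Sobolev functions are imposed almost everywhere.
\<close>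

definition half_space :: "'n::finite \<Rightarrow> (real ^ 'n) set" where
  "half_space k = {x. 0 < x $ k}"

definition half_ball :: "'n::finite \<Rightarrow> (real ^ 'n) set" where
  "half_ball k = ball 0 1 \<inter> half_space k"

definition antisymmetric_in :: "'n::finite \<Rightarrow> (real ^ 'n \<Rightarrow> real) \<Rightarrow> bool" where
  "antisymmetric_in k u \<longleftrightarrow> (\<forall>x. u (\<chi> j. if j = k then - (x $ j) else x $ j) = - u x)"

definition L2_fun :: "('a::euclidean_space \<Rightarrow> real) set" where
  "L2_fun = {u. u \<in> borel_measurable lebesgue \<and> integrable lebesgue (\<lambda>x. (u x)\<^sup>2)}"

definition Linf_on :: "'a::euclidean_space set \<Rightarrow> ('a \<Rightarrow> real) set" where
  "Linf_on \<Omega> = {c. c \<in> borel_measurable (lebesgue_on \<Omega>) \<and>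
                   (\<exists>M. AE x in lebesgue_on \<Omega>. \<bar>c x\<bar> \<le> M)}"

text \<open>On the diagonal, a null set, the kernels below take the value \<open>0 / 0 = 0\<close>.\<close>

definition Hs :: "real \<Rightarrow> (real ^ 'n::finite \<Rightarrow> real) set" where
  "Hs s = {u \<in> L2_fun.
     integrable (lebesgue :: ((real ^ 'n) \<times> (real ^ 'n)) measure)
       (\<lambda>(x, y). \<bar>u x - u y\<bar>\<^sup>2 / norm (x - y) powr (real CARD('n) + 2 * s))}"

definition Hs0 :: "real \<Rightarrow> (real ^ 'n::finite) set \<Rightarrow> (real ^ 'n \<Rightarrow> real) set" where
  "Hs0 s \<Omega> = {v \<in> Hs s. AE x in lebesgue. x \<notin> \<Omega> \<longrightarrow> v x = 0}"

definition frac_const :: "nat \<Rightarrow> real \<Rightarrow> real" where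
  "frac_const n s = s * 4 powr s * Gamma ((real n + 2 * s) / 2) / Gamma (1 - s)"

definition frac_form :: "real \<Rightarrow> (real ^ 'n::finite \<Rightarrow> real) \<Rightarrow> (real ^ 'n \<Rightarrow> real) \<Rightarrow> real" where
  "frac_form s u v = frac_const CARD('n) s / 2 *
     (\<integral>(x, y). (u x - u y) * (v x - v y) / norm (x - y) powr (real CARD('n) + 2 * s)
        \<partial>(lebesgue :: ((real ^ 'n) \<times> (real ^ 'n)) measure))"

text \<open>\<open>(-\<Delta>)\<^sup>s u + c u \<ge> 0\<close> in \<open>\<Omega>\<close> in the weak sense, for \<open>u \<in> Hs s\<close> and \<open>c \<in> Linf_on \<Omega>\<close>.\<close>

definition weak_supersolution ::
  "real \<Rightarrow> (real ^ 'n::finite) set \<Rightarrow> (real ^ 'n \<Rightarrow> real) \<Rightarrow> (real ^ 'n \<Rightarrow> real) \<Rightarrow> bool" where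
  "weak_supersolution s \<Omega> c u \<longleftrightarrow>
     (\<forall>v \<in> Hs0 s \<Omega>. (AE x in lebesgue. 0 \<le> v x) \<longrightarrow>
        0 \<le> frac_form s u v + (\<integral>x. c x * u x * v x \<partial>lebesgue_on \<Omega>))"

end

theory Submission imports Defs begin

text \<open>
  Write \<open>n\<close> for the dimension, \<open>p = n + 2 s\<close>, \<open>R\<close> for the reflection that changes the sign of the \<open>k\<close>-th
  coordinate, \<open>H\<close> for the half-space, \<open>\<psi>(x) = x\<^sub>k (max 0 (1 - |x|\<^sup>2))\<^sup>2\<close> and
  \<open>I(f, g)\<close> for the double integral of \<open>(f x - f y) (g x - g y) / |x - y|\<^sup>p\<close>. The function \<open>u\<close> stays above
  a small multiple \<open>d \<psi>\<close> in the half ball, and \<open>\<psi>\<close> grows linearly along \<open>e\<^sub>1\<close>; this is the claim.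

  To compare, put \<open>w = d \<psi> - u\<close> and test the equation with \<open>v\<close>, the positive part of \<open>w\<close> cut off to
  \<open>H\<close>. Since \<open>u \<ge> 0\<close> on \<open>H\<close>, \<open>0 \<le> v \<le> d \<psi>\<close>, so that \<open>v\<close> lives in the half ball; it has finite energy
  (\<open>finite_energy_half_pos_part\<close>) although it is only a truncation, because \<open>w\<close> is odd. Let \<open>X\<close> be the
  integral of \<open>x\<^sub>k v\<close>. Three estimates are linear in \<open>X\<close>.

  \<^item> \<open>I(\<psi>, v) \<le> \<Lambda> X\<close> (\<open>energy_form_profile_le\<close>). Substituting \<open>y = x + z\<close> and translating moves the
    difference from \<open>v\<close> to \<open>\<psi>\<close>, so that no principal value appears. Averaging over \<open>z\<close> and \<open>R z\<close> makes
    the second difference of \<open>\<psi>\<close> vanish on the hyperplane, which produces the factor \<open>x\<^sub>k\<close>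
    (\<open>profile_averaged_second_difference_ge\<close>).

  \<^item> \<open>I(w, v) \<ge> \<gamma> X\<close> with \<open>\<gamma> > 0\<close> independent of \<open>d\<close> (\<open>energy_form_half_pos_part_ge\<close>). Folding both
    variables into \<open>H\<close> replaces the kernel by its difference with the reflected kernel. On a fixed ball
    \<open>K\<close> in the half ball \<open>u\<close> is at least some \<open>m > 0\<close>, hence \<open>w \<le> - m / 2\<close> there for small \<open>d\<close>. The
    interaction of this negative part with \<open>v\<close> gives the lower bound, since for \<open>x \<in> K\<close> the difference
    of the kernels is at least a multiple of \<open>y\<^sub>k\<close> (\<open>kernel_reflection_gap\<close>).

  \<^item> The integral of \<open>c u v\<close> is at most \<open>C d X\<close>, because \<open>u < d \<psi> \<le> d x\<^sub>k\<close> where \<open>v > 0\<close>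
    (\<open>reaction_integral_le\<close>).

  As \<open>I(u, v) = d I(\<psi>, v) - I(w, v)\<close>, the weak inequality becomes
  \<open>0 \<le> (d (a \<Lambda> + C) - a \<gamma>) X\<close> with \<open>a\<close> half the normalisation constant. For small \<open>d\<close> the bracket is
  negative, so \<open>X = 0\<close>, \<open>v\<close> vanishes almost everywhere, and \<open>d \<psi> \<le> u\<close> in the half ball by continuity.

  All integrals are computed for a Borel representative of \<open>u\<close> that is odd everywhere, nonnegative on
  \<open>H\<close> and at least \<open>m\<close> on \<open>K\<close> (\<open>antisymmetric_borel_representative\<close>), so that Fubini's theorem applies
  to the product of two Borel measures.
\<close>

section \<open>The truncated kernel is integrable\<close>

lemma dyadic_bracket:
  fixes t :: real
  assumes "1 \<le> t"
  obtains j :: nat where "2 ^ j \<le> t" "t < 2 ^ Suc j"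
proof -
  obtain n where n: "t < 2 ^ n"
    using real_arch_pow[of 2 t] by auto
  define m where "m = (LEAST n. t < 2 ^ n)"
  have m: "t < 2 ^ m" unfolding m_def using n by (rule LeastI)
  then obtain j where j: "m = Suc j" using assms by (cases m) auto
  have "\<not> t < 2 ^ j" using not_less_Least[of j "\<lambda>n. t < 2 ^ n"] j m_def by simp
  with m j that[of j] show ?thesis by simp
qed

text \<open>
  On the annulus \<open>2\<^sup>j \<le> |z| < 2\<^sup>j\<^sup>+\<^sup>1\<close> the integrand is at most \<open>2\<^sup>-\<^sup>j\<^sup>p\<close> and the volume is of
  order \<open>2\<^sup>j\<^sup>n\<close>, which leaves a geometric series with ratio \<open>2 powr (-2 s) < 1\<close>. On the annuli that
  shrink to the origin the factor \<open>|z|\<^sup>2\<close> leaves a geometric series with ratio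
  \<open>2 powr (2 s) / 4 < 1\<close>.
\<close>

lemma integrable_truncated_kernel:
  fixes s :: real
  assumes s: "0 < s" "s < 1" and p: "p = real DIM('a::euclidean_space) + 2 * s"
  shows "integrable lborel (\<lambda>z::'a. min 1 ((norm z)\<^sup>2) / norm z powr p)"
proof (rule integrableI_nonneg)
  let ?f = "\<lambda>z::'a. min 1 ((norm z)\<^sup>2) / norm z powr p"
  let ?V = "unit_ball_vol (real DIM('a))"
  let ?n = "DIM('a)"
  have V: "0 \<le> ?V" by simp
  \<comment> \<open>\<open>a j\<close> bounds the integrand on the \<open>j\<close>-th annulus outside the unit ball, \<open>b j\<close> on the \<open>j\<close>-th one
    inside. Extending the bounds to whole balls keeps the series geometric.\<close>
  define a where "a j = 1 / (2 ^ j) powr p" for j :: nat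
  define b where "b j = ((1/2) ^ j)\<^sup>2 * (2 ^ Suc j) powr p" for j :: nat
  define g where "g j z = ennreal (a j) * indicator (ball 0 (2 ^ Suc j)) z" for j and z :: 'a
  define h where "h j z = ennreal (b j) * indicator (ball 0 (2 * (1/2) ^ j)) z" for j and z :: 'a
  have mg: "g j \<in> borel_measurable lborel" for j
    unfolding g_def by (intro borel_measurable_times_ennreal borel_measurable_const borel_measurable_indicator) simp
  have mh: "h j \<in> borel_measurable lborel" for j
    unfolding h_def by (intro borel_measurable_times_ennreal borel_measurable_const borel_measurable_indicator) simp
  have nonneg: "0 \<le> a j" "0 \<le> b j" for j by (auto simp: a_def b_def)
  have p0: "0 \<le> p" using s p by simp
  show "?f \<in> borel_measurable lborel" by measurable
  show "AE z in lborel. 0 \<le> ?f z" by (intro always_eventually allI) auto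
  have pt: "ennreal (?f z) \<le> (\<Sum>j. g j z) + (\<Sum>j. h j z)" for z
  proof (cases "z = 0")
    case False
    show ?thesis
    proof (cases "1 \<le> norm z")
      case True
      obtain j where j: "2 ^ j \<le> norm z" "norm z < 2 ^ Suc j" using dyadic_bracket[OF True] .
      have "?f z \<le> 1 / norm z powr p" by (intro divide_right_mono) auto
      also have "\<dots> \<le> a j"
        unfolding a_def using j p0 by (intro divide_left_mono powr_mono2 mult_pos_pos) (auto simp: False)
      finally have "ennreal (?f z) \<le> ennreal (a j)" by (rule ennreal_leI)
      also have "\<dots> = g j z" using j by (simp add: g_def)
      also have "\<dots> = (\<Sum>i\<in>{j}. g i z)" by simp
      also have "\<dots> \<le> (\<Sum>j. g j z)" by (rule sum_le_suminf) auto
      finally show ?thesis by (rule order_trans) simp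
    next
      case lt: False
      have "1 \<le> 1 / norm z" using lt False by (simp add: field_simps)
      from dyadic_bracket[OF this] obtain j where j0: "2 ^ j \<le> 1 / norm z" "1 / norm z < 2 ^ Suc j" .
      have j: "norm z \<le> (1/2) ^ j" "1 / 2 ^ Suc j \<le> norm z"
        using j0 False by (auto simp: field_simps power_divide)
      have j': "norm z < 2 * (1/2) ^ j"
        by (rule le_less_trans[OF j(1)]) simp
      have "1 / norm z powr p \<le> (2 ^ Suc j) powr p"
      proof -
        have "1 / norm z powr p = (1 / norm z) powr p"
          by (simp add: powr_divide)
        also have "\<dots> \<le> (2 ^ Suc j) powr p" using j0 p0 by (intro powr_mono2) auto
        finally show ?thesis .
      qed
      moreover have "min 1 ((norm z)\<^sup>2) \<le> ((1/2) ^ j)\<^sup>2"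
        by (rule min.coboundedI2) (use j in \<open>intro power_mono; simp\<close>)
      ultimately have "min 1 ((norm z)\<^sup>2) * (1 / norm z powr p) \<le> b j"
        unfolding b_def by (intro mult_mono) auto
      then have "?f z \<le> b j" by simp
      then have "ennreal (?f z) \<le> ennreal (b j)" by (rule ennreal_leI)
      also have "\<dots> = h j z" using j' by (simp add: h_def)
      also have "\<dots> = (\<Sum>i\<in>{j}. h i z)" by simp
      also have "\<dots> \<le> (\<Sum>j. h j z)" by (rule sum_le_suminf) auto
      finally show ?thesis by (rule order_trans) simp
    qed
  qed simp
  have fin: "(\<Sum>j. ennreal (C * q ^ j)) < \<infinity>" if "0 \<le> C" "0 \<le> q" "q < 1" for C q :: real
  proof -
    have "summable (\<lambda>j. C * q ^ j)" using that by (intro summable_mult summable_geometric) auto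
    then have "(\<Sum>j. ennreal (C * q ^ j)) = ennreal (\<Sum>j. C * q ^ j)"
      using that by (intro suminf_ennreal2) auto
    then show ?thesis by simp
  qed
  have pw: "((2::real) ^ j) powr p = 2 ^ (j * ?n) * (2 powr (2 * s)) ^ j" for j
  proof -
    have "((2::real) ^ j) powr p = 2 powr (real j * real ?n + real j * (2 * s))"
      by (simp add: p powr_realpow[symmetric] powr_powr distrib_left)
    also have "\<dots> = 2 powr real (j * ?n) * (2 powr (2 * s)) powr real j"
      by (simp only: powr_add powr_powr of_nat_mult mult.commute[of "real j"])
    also have "\<dots> = 2 ^ (j * ?n) * (2 powr (2 * s)) ^ j"
      by (subst (1 2) powr_realpow) auto
    finally show ?thesis .
  qed
  have "(\<integral>\<^sup>+z. (\<Sum>j. g j z) \<partial>lborel) = (\<Sum>j. \<integral>\<^sup>+z. g j z \<partial>lborel)"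
    by (rule nn_integral_suminf[OF mg])
  also have "\<dots> = (\<Sum>j. ennreal ((2 ^ ?n * ?V) * (2 powr (- 2 * s)) ^ j))"
  proof (intro suminf_cong)
    fix j
    have "(\<integral>\<^sup>+z. g j z \<partial>lborel) = ennreal (a j) * ennreal (?V * (2 ^ Suc j) ^ ?n)"
      unfolding g_def by (subst nn_integral_cmult_indicator) (auto simp: emeasure_ball)
    also have "\<dots> = ennreal (a j * (?V * (2 ^ Suc j) ^ ?n))"
      using nonneg by (simp add: ennreal_mult)
    also have "a j * (?V * (2 ^ Suc j) ^ ?n) = (2 ^ ?n * ?V) * (2 powr (- 2 * s)) ^ j"
    proof -
      have "(2 powr (- 2 * s)) ^ j = 1 / (2 powr (2 * s)) ^ j"
        by (simp add: powr_minus_divide power_one_over)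
      moreover have "((2::real) ^ Suc j) ^ ?n = 2 ^ ?n * 2 ^ (j * ?n)"
        by (simp add: power_mult_distrib power_mult)
      ultimately show ?thesis unfolding a_def pw by (simp add: field_simps)
    qed
    finally show "(\<integral>\<^sup>+z. g j z \<partial>lborel) = ennreal ((2 ^ ?n * ?V) * (2 powr (- 2 * s)) ^ j)" .
  qed
  also have "\<dots> < \<infinity>" using V s by (intro fin) (auto simp: powr_less_one)
  finally have G: "(\<integral>\<^sup>+z. (\<Sum>j. g j z) \<partial>lborel) < \<infinity>" .
  have "(\<integral>\<^sup>+z. (\<Sum>j. h j z) \<partial>lborel) = (\<Sum>j. \<integral>\<^sup>+z. h j z \<partial>lborel)"
    by (rule nn_integral_suminf[OF mh])
  also have "\<dots> = (\<Sum>j. ennreal ((2 powr p * 2 ^ ?n * ?V) * (2 powr (2 * s) / 4) ^ j))"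
  proof (intro suminf_cong)
    fix j
    have "(\<integral>\<^sup>+z. h j z \<partial>lborel) = ennreal (b j) * ennreal (?V * (2 * (1/2) ^ j) ^ ?n)"
      unfolding h_def by (subst nn_integral_cmult_indicator) (auto simp: emeasure_ball)
    also have "\<dots> = ennreal (b j * (?V * (2 * (1/2) ^ j) ^ ?n))"
      using nonneg by (simp add: ennreal_mult)
    also have "b j * (?V * (2 * (1/2) ^ j) ^ ?n) = (2 powr p * 2 ^ ?n * ?V) * (2 powr (2 * s) / 4) ^ j"
    proof -
      have e1: "(2 ^ Suc j) powr p = 2 powr p * (2 ^ (j * ?n) * (2 powr (2 * s)) ^ j)"
        by (simp add: powr_mult pw)
      have "((1/2::real) ^ j)\<^sup>2 = 1 / 4 ^ j"
        by (simp add: power_divide power2_eq_square power_mult_distrib[symmetric])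
      moreover have "(2 powr (2 * s) / 4) ^ j = (2 powr (2 * s)) ^ j / 4 ^ j"
        by (rule power_divide)
      moreover have "(2 * (1/2::real) ^ j) ^ ?n = 2 ^ ?n / 2 ^ (j * ?n)"
        by (simp add: power_mult_distrib power_divide power_mult)
      ultimately show ?thesis unfolding b_def e1 by (simp add: field_simps)
    qed
    finally show "(\<integral>\<^sup>+z. h j z \<partial>lborel) = ennreal ((2 powr p * 2 ^ ?n * ?V) * (2 powr (2 * s) / 4) ^ j)" .
  qed
  also have "\<dots> < \<infinity>"
  proof (intro fin)
    have "2 powr (2 * s) < 2 powr (2::real)" using s by (intro powr_less_mono) auto
    then show "2 powr (2 * s) / 4 < 1" by simp
  qed (use V in auto)
  finally have H: "(\<integral>\<^sup>+z. (\<Sum>j. h j z) \<partial>lborel) < \<infinity>" .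
  have "(\<integral>\<^sup>+z. ennreal (?f z) \<partial>lborel) \<le> (\<integral>\<^sup>+z. (\<Sum>j. g j z) + (\<Sum>j. h j z) \<partial>lborel)"
    by (intro nn_integral_mono pt)
  also have "\<dots> = (\<integral>\<^sup>+z. (\<Sum>j. g j z) \<partial>lborel) + (\<integral>\<^sup>+z. (\<Sum>j. h j z) \<partial>lborel)"
    by (rule nn_integral_add[OF borel_measurable_suminf_order[OF mg] borel_measurable_suminf_order[OF mh]])
  also have "\<dots> < \<infinity>" using G H by (simp add: less_top)
  finally show "(\<integral>\<^sup>+z. ennreal (?f z) \<partial>lborel) < \<infinity>" .
qed

section \<open>Measure-preserving maps: shear and reflection\<close>

text \<open>
  For fixed \<open>x\<close> the map is a translation, so this is Tonelli's theorem. It justifies the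
  substitution \<open>y = x + z\<close>.
\<close>

lemma distr_shear:
  "distr (lborel \<Otimes>\<^sub>M lborel) (lborel \<Otimes>\<^sub>M lborel) (\<lambda>(x, z). (x, x + z)) =
    (lborel \<Otimes>\<^sub>M lborel :: ('a::euclidean_space \<times> 'a) measure)"
  (is "distr ?M ?M ?T = ?M")
proof (rule measure_eqI)
  fix A assume "A \<in> sets (distr ?M ?M ?T)"
  then have A: "A \<in> sets ?M" by (simp only: sets_distr)
  have T: "?T \<in> ?M \<rightarrow>\<^sub>M ?M" by measurable
  have TA: "?T -` A \<inter> space ?M \<in> sets ?M" by (rule measurable_sets[OF T A])
  have "emeasure (distr ?M ?M ?T) A = emeasure ?M (?T -` A \<inter> space ?M)"
    by (rule emeasure_distr[OF T A])
  also have "\<dots> = (\<integral>\<^sup>+x. emeasure lborel (Pair x -` (?T -` A \<inter> space ?M)) \<partial>lborel)"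
    by (rule lborel.emeasure_pair_measure_alt[OF TA])
  also have "\<dots> = (\<integral>\<^sup>+x. emeasure lborel (Pair x -` A) \<partial>lborel)"
  proof (rule nn_integral_cong)
    fix x :: 'a
    have "Pair x -` A \<in> sets lborel" by (rule sets_Pair1[OF A])
    then have "emeasure (distr lborel borel ((+) x)) (Pair x -` A) = emeasure lborel ((+) x -` (Pair x -` A) \<inter> space lborel)"
      by (intro emeasure_distr) auto
    also have "(+) x -` (Pair x -` A) \<inter> space lborel = Pair x -` (?T -` A \<inter> space ?M)"
      by (auto simp: space_pair_measure)
    finally show "emeasure lborel (Pair x -` (?T -` A \<inter> space ?M)) = emeasure lborel (Pair x -` A)"
      by (simp only: lborel_distr_plus)
  qed
  also have "\<dots> = emeasure ?M A"
    by (rule lborel.emeasure_pair_measure_alt[OF A, symmetric])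
  finally show "emeasure (distr ?M ?M ?T) A = emeasure ?M A" .
qed (simp only: sets_distr)

definition reflection :: "'n::finite \<Rightarrow> real ^ 'n \<Rightarrow> real ^ 'n" where
  "reflection k x = (\<chi> j. if j = k then - (x $ j) else x $ j)"

lemma reflection_nth [simp]: "reflection k x $ j = (if j = k then - (x $ j) else x $ j)"
  by (simp add: reflection_def)

lemma reflection_reflection [simp]: "reflection k (reflection k x) = x"
  by (simp add: vec_eq_iff)

lemma reflection_add: "reflection k (x + y) = reflection k x + reflection k y"
  and reflection_diff: "reflection k (x - y) = reflection k x - reflection k y"
  and reflection_minus: "reflection k (- x) = - reflection k x"
  by (simp_all add: vec_eq_iff)

lemma reflection_eq: "reflection k x = x - (2 * x $ k) *\<^sub>R axis k 1"
  by (simp add: vec_eq_iff axis_def)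

lemma norm_reflection [simp]: "norm (reflection k x) = norm x"
  unfolding norm_vec_def L2_set_def by (rule arg_cong[where f = sqrt], rule sum.cong) auto

lemma norm_reflection_diff:
  "norm (reflection k x - y) = norm (x - reflection k y)"
  using norm_reflection[of k "reflection k x - y"] by (simp add: reflection_diff)

text \<open>
  Two points on the same side of the hyperplane move apart when one of them is reflected, and
  the gain in squared distance is proportional to both distances to the hyperplane. Every factor
  \<open>x\<^sub>k\<close> gained from the kernel comes from here.
\<close>

lemma norm_diff_reflection_sq:
  "(norm (x - reflection k y))\<^sup>2 = (norm (x - y))\<^sup>2 + 4 * x $ k * y $ k"
proof -
  have "(x - reflection k y) = (x - y) + (2 * y $ k) *\<^sub>R axis k 1"
    by (simp add: reflection_eq)
  then show ?thesis
    by (simp only: power2_norm_eq_inner)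
      (simp add: inner_add_left inner_add_right inner_axis inner_commute[of "axis k 1"] algebra_simps power2_eq_square)
qed

lemma continuous_on_reflection [continuous_intros]: "continuous_on S (reflection k)"
  unfolding reflection_eq[abs_def] by (intro continuous_intros)

lemma borel_measurable_reflection [measurable]: "reflection k \<in> borel \<rightarrow>\<^sub>M borel"
  by (intro borel_measurable_continuous_onI continuous_intros)

lemma distr_reflection: "distr lborel borel (reflection k) = (lborel :: (real ^ 'n::finite) measure)"
proof -
  define c :: "real ^ 'n \<Rightarrow> real" where "c j = (if j = axis k 1 then -1 else 1)" for j
  have Bk: "axis k (1::real) \<in> Basis" by (auto simp: Basis_vec_def)
  have T: "0 + (\<Sum>j\<in>Basis. (c j * (x \<bullet> j)) *\<^sub>R j) = reflection k x" for x :: "real ^ 'n"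
  proof -
    have "(\<Sum>j\<in>Basis. (c j * (x \<bullet> j)) *\<^sub>R j) =
        (\<Sum>j\<in>Basis. (x \<bullet> j) *\<^sub>R j - (if j = axis k 1 then (2 * (x \<bullet> j)) *\<^sub>R j else 0))"
      by (rule sum.cong) (auto simp: c_def scaleR_2[symmetric] simp flip: scaleR_diff_left scaleR_add_left)
    also have "\<dots> = x - (2 * x $ k) *\<^sub>R axis k 1"
      using Bk by (simp add: sum_subtractf euclidean_representation inner_axis)
    finally show ?thesis by (simp add: reflection_eq)
  qed
  have "(lborel :: (real ^ 'n) measure) =
      density (distr lborel borel (\<lambda>x. 0 + (\<Sum>j\<in>Basis. (c j * (x \<bullet> j)) *\<^sub>R j))) (\<lambda>_. (\<Prod>j\<in>Basis. \<bar>c j\<bar>))"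
    by (rule lborel_affine_euclidean) (simp add: c_def)
  also have "(\<Prod>j\<in>Basis. \<bar>c j\<bar>) = 1" by (rule prod.neutral) (auto simp: c_def)
  finally show ?thesis by (simp only: T ennreal_1 density_1)
qed

lemma integrable_product_fun:
  fixes f :: "'a::euclidean_space \<Rightarrow> real" and g :: "'b::euclidean_space \<Rightarrow> real"
  assumes f: "integrable lborel f" and g: "integrable lborel g"
  shows "integrable (lborel \<Otimes>\<^sub>M lborel) (\<lambda>(x, y). f x * g y)"
    and "(\<integral>(x, y). f x * g y \<partial>(lborel \<Otimes>\<^sub>M lborel)) = (\<integral>x. f x \<partial>lborel) * (\<integral>y. g y \<partial>lborel)"
proof -
  have [measurable]: "f \<in> borel_measurable lborel" "g \<in> borel_measurable lborel" using f g by auto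
  show i: "integrable (lborel \<Otimes>\<^sub>M lborel) (\<lambda>(x, y). f x * g y)"
  proof (rule lborel_pair.Fubini_integrable)
    show "(\<lambda>(x, y). f x * g y) \<in> borel_measurable (lborel \<Otimes>\<^sub>M lborel)"
      by measurable
    show "integrable lborel (\<lambda>x. \<integral>y. norm (case (x, y) of (x, y) \<Rightarrow> f x * g y) \<partial>lborel)"
      using f by (simp add: abs_mult)
    show "AE x in lborel. integrable lborel (\<lambda>y. case (x, y) of (x, y) \<Rightarrow> f x * g y)"
      using g by simp
  qed
  show "(\<integral>(x, y). f x * g y \<partial>(lborel \<Otimes>\<^sub>M lborel)) = (\<integral>x. f x \<partial>lborel) * (\<integral>y. g y \<partial>lborel)"
    by (subst lborel_pair.integral_fst[OF i, symmetric]) simp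
qed

lemma
  fixes f :: "'a::euclidean_space \<times> 'a \<Rightarrow> real"
  assumes f: "f \<in> borel_measurable (lborel \<Otimes>\<^sub>M lborel)"
  shows integrable_shear: "integrable (lborel \<Otimes>\<^sub>M lborel) (\<lambda>(x, z). f (x, x + z)) \<longleftrightarrow>
      integrable (lborel \<Otimes>\<^sub>M lborel) f"
    and integral_shear: "(\<integral>(x, z). f (x, x + z) \<partial>(lborel \<Otimes>\<^sub>M lborel)) = (\<integral>w. f w \<partial>(lborel \<Otimes>\<^sub>M lborel))"
proof -
  let ?M = "lborel \<Otimes>\<^sub>M lborel :: ('a \<times> 'a) measure"
  have T: "(\<lambda>(x::'a, z). (x, x + z)) \<in> ?M \<rightarrow>\<^sub>M ?M" by measurable
  show "integrable ?M (\<lambda>(x, z). f (x, x + z)) \<longleftrightarrow> integrable ?M f"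
    using integrable_distr_eq[OF T f, unfolded distr_shear] by (simp only: case_prod_unfold)
  show "(\<integral>(x, z). f (x, x + z) \<partial>?M) = (\<integral>w. f w \<partial>?M)"
    using integral_distr[OF T f, unfolded distr_shear] by (simp only: case_prod_unfold)
qed

lemma sigma_finite_distr_reflection: "sigma_finite_measure (distr lborel borel (reflection k))"
  unfolding distr_reflection by (rule sigma_finite_lborel)

lemma distr_reflection_fst:
  "distr (lborel \<Otimes>\<^sub>M lborel) (lborel \<Otimes>\<^sub>M lborel) (\<lambda>(x, y). (reflection k x, y)) =
    (lborel \<Otimes>\<^sub>M lborel :: ((real ^ 'n::finite) \<times> 'b::euclidean_space) measure)"
proof -
  have "distr lborel borel (reflection k) \<Otimes>\<^sub>M distr lborel borel (\<lambda>y::'b. y) =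
    distr (lborel \<Otimes>\<^sub>M lborel) (borel \<Otimes>\<^sub>M borel) (\<lambda>(x, y). (reflection k x, y))"
    by (rule pair_measure_distr) (auto simp: distr_id2 sigma_finite_lborel)
  moreover have "distr lborel borel (\<lambda>y::'b. y) = lborel" by (rule distr_id2) simp
  ultimately have "distr (lborel \<Otimes>\<^sub>M lborel) (borel \<Otimes>\<^sub>M borel) (\<lambda>(x, y). (reflection k x, y)) =
    (lborel \<Otimes>\<^sub>M lborel :: ((real ^ 'n) \<times> 'b) measure)"
    by (simp only: distr_reflection)
  moreover have "sets (lborel \<Otimes>\<^sub>M lborel :: ((real ^ 'n) \<times> 'b) measure) = sets (borel \<Otimes>\<^sub>M borel)"
    by (intro sets_pair_measure_cong) auto
  ultimately show ?thesis by (metis (no_types, lifting) distr_cong)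
qed

lemma distr_reflection_snd:
  "distr (lborel \<Otimes>\<^sub>M lborel) (lborel \<Otimes>\<^sub>M lborel) (\<lambda>(x, y). (x, reflection k y)) =
    (lborel \<Otimes>\<^sub>M lborel :: ('b::euclidean_space \<times> (real ^ 'n::finite)) measure)"
proof -
  have "distr lborel borel (\<lambda>y::'b. y) \<Otimes>\<^sub>M distr lborel borel (reflection k) =
    distr (lborel \<Otimes>\<^sub>M lborel) (borel \<Otimes>\<^sub>M borel) (\<lambda>(x, y). (x, reflection k y))"
    by (rule pair_measure_distr) (auto simp: sigma_finite_distr_reflection)
  moreover have "distr lborel borel (\<lambda>y::'b. y) = lborel" by (rule distr_id2) simp
  ultimately have "distr (lborel \<Otimes>\<^sub>M lborel) (borel \<Otimes>\<^sub>M borel) (\<lambda>(x, y). (x, reflection k y)) =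
    (lborel \<Otimes>\<^sub>M lborel :: ('b \<times> (real ^ 'n)) measure)"
    by (simp only: distr_reflection)
  moreover have "sets (lborel \<Otimes>\<^sub>M lborel :: ('b \<times> (real ^ 'n)) measure) = sets (borel \<Otimes>\<^sub>M borel)"
    by (intro sets_pair_measure_cong) auto
  ultimately show ?thesis by (metis (no_types, lifting) distr_cong)
qed

lemma
  fixes f :: "(real ^ 'n::finite) \<times> (real ^ 'n) \<Rightarrow> real"
  assumes f: "f \<in> borel_measurable (lborel \<Otimes>\<^sub>M lborel)"
  shows integrable_reflection_fst: "integrable (lborel \<Otimes>\<^sub>M lborel) (\<lambda>(x, y). f (reflection k x, y)) \<longleftrightarrow>
      integrable (lborel \<Otimes>\<^sub>M lborel) f"
    and integral_reflection_fst: "(\<integral>(x, y). f (reflection k x, y) \<partial>(lborel \<Otimes>\<^sub>M lborel)) = (\<integral>w. f w \<partial>(lborel \<Otimes>\<^sub>M lborel))"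
    and integrable_reflection_snd: "integrable (lborel \<Otimes>\<^sub>M lborel) (\<lambda>(x, y). f (x, reflection k y)) \<longleftrightarrow>
      integrable (lborel \<Otimes>\<^sub>M lborel) f"
    and integral_reflection_snd: "(\<integral>(x, y). f (x, reflection k y) \<partial>(lborel \<Otimes>\<^sub>M lborel)) = (\<integral>w. f w \<partial>(lborel \<Otimes>\<^sub>M lborel))"
proof -
  let ?M = "lborel \<Otimes>\<^sub>M lborel :: ((real ^ 'n) \<times> (real ^ 'n)) measure"
  have T: "(\<lambda>(x, y). (reflection k x, y)) \<in> ?M \<rightarrow>\<^sub>M ?M" by measurable
  have U: "(\<lambda>(x, y). (x, reflection k y)) \<in> ?M \<rightarrow>\<^sub>M ?M" by measurable
  show "integrable ?M (\<lambda>(x, y). f (reflection k x, y)) \<longleftrightarrow> integrable ?M f"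
    using integrable_distr_eq[OF T f, unfolded distr_reflection_fst] by (simp only: case_prod_unfold)
  show "(\<integral>(x, y). f (reflection k x, y) \<partial>?M) = (\<integral>w. f w \<partial>?M)"
    using integral_distr[OF T f, unfolded distr_reflection_fst] by (simp only: case_prod_unfold)
  show "integrable ?M (\<lambda>(x, y). f (x, reflection k y)) \<longleftrightarrow> integrable ?M f"
    using integrable_distr_eq[OF U f, unfolded distr_reflection_snd] by (simp only: case_prod_unfold)
  show "(\<integral>(x, y). f (x, reflection k y) \<partial>?M) = (\<integral>w. f w \<partial>?M)"
    using integral_distr[OF U f, unfolded distr_reflection_snd] by (simp only: case_prod_unfold)
qed

text \<open>
  The indicator of the half-space, with the value \<open>1 / 2\<close> on the hyperplane. With this choice
  the weights at \<open>x\<close> and at its mirror image add up to \<open>1\<close> at every point, and folding an integral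
  discards no null set.
\<close>

definition half_weight :: "'n::finite \<Rightarrow> real ^ 'n \<Rightarrow> real" where
  "half_weight k x = (1 + sgn (x $ k)) / 2"

lemma half_weight_reflection: "half_weight k (reflection k x) = 1 - half_weight k x"
  by (simp add: half_weight_def sgn_minus field_simps)

lemma half_weight_measurable [measurable]: "half_weight k \<in> borel_measurable borel"
  unfolding half_weight_def[abs_def] by measurable

lemma half_weight_bounds: "0 \<le> half_weight k x" "half_weight k x \<le> 1"
  by (auto simp: half_weight_def sgn_if)

lemma abs_half_weight_le_1: "\<bar>half_weight k x\<bar> \<le> 1"
  using half_weight_bounds[of k x] by simp

lemma half_weight_neg: "x $ k < 0 \<Longrightarrow> half_weight k x = 0"
  and half_weight_pos: "0 < x $ k \<Longrightarrow> half_weight k x = 1"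
  by (auto simp: half_weight_def)

text \<open>
  Insert \<open>1 = \<sigma> x + \<sigma> (R x)\<close> in each variable, with \<open>\<sigma>\<close> the half weight, and reflect the
  variables that lie on the wrong side.
\<close>

lemma integral_fold:
  fixes g :: "real ^ 'n::finite \<Rightarrow> real ^ 'n \<Rightarrow> real"
  defines "M \<equiv> lborel \<Otimes>\<^sub>M lborel :: ((real ^ 'n) \<times> (real ^ 'n)) measure"
  assumes g: "integrable M (\<lambda>(x, y). g x y)"
  shows "integrable M (\<lambda>(x, y). half_weight k x * half_weight k y *
      (g x y + g (reflection k x) y + g x (reflection k y) + g (reflection k x) (reflection k y)))" (is ?A)
    and "(\<integral>(x, y). g x y \<partial>M) = (\<integral>(x, y). half_weight k x * half_weight k y *
      (g x y + g (reflection k x) y + g x (reflection k y) + g (reflection k x) (reflection k y)) \<partial>M)" (is ?B)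
proof -
  let ?\<sigma> = "half_weight k" and ?R = "reflection k"
  have weighted: "integrable M (\<lambda>(x, y). ?\<sigma> x * h x y)" "integrable M (\<lambda>(x, y). ?\<sigma> y * h x y)"
    if h: "integrable M (\<lambda>(x, y). h x y)" for h :: "real ^ 'n \<Rightarrow> real ^ 'n \<Rightarrow> real"
  proof -
    have m: "(\<lambda>(x, y). h x y) \<in> borel_measurable M" using h by auto
    have s: "(\<lambda>(x, y). ?\<sigma> x) \<in> borel_measurable M" "(\<lambda>(x, y). ?\<sigma> y) \<in> borel_measurable M"
      unfolding M_def by measurable
    show "integrable M (\<lambda>(x, y). ?\<sigma> x * h x y)"
      by (rule Bochner_Integration.integrable_bound[OF h])
        (use borel_measurable_times[OF s(1) m] abs_half_weight_le_1 in
          \<open>auto simp: case_prod_unfold abs_mult intro!: mult_left_le_one_le always_eventually\<close>)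
    show "integrable M (\<lambda>(x, y). ?\<sigma> y * h x y)"
      by (rule Bochner_Integration.integrable_bound[OF h])
        (use borel_measurable_times[OF s(2) m] abs_half_weight_le_1 in
          \<open>auto simp: case_prod_unfold abs_mult intro!: mult_left_le_one_le always_eventually\<close>)
  qed
  have fst_fold: "integrable M (\<lambda>(x, y). ?\<sigma> x * (h x y + h (?R x) y)) \<and>
     (\<integral>(x, y). h x y \<partial>M) = (\<integral>(x, y). ?\<sigma> x * (h x y + h (?R x) y) \<partial>M)"
    if h: "integrable M (\<lambda>(x, y). h x y)" for h :: "real ^ 'n \<Rightarrow> real ^ 'n \<Rightarrow> real"
  proof -
    note w1 = weighted(1)[OF h]
    have hm: "(\<lambda>(x, y). h x y) \<in> borel_measurable (lborel \<Otimes>\<^sub>M lborel)" using h unfolding M_def by auto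
    have hR: "integrable M (\<lambda>(x, y). h (?R x) y)"
      using integrable_reflection_fst[OF hm, of k] h by (simp add: M_def)
    note w2 = weighted(1)[OF hR]
    have w2m: "(\<lambda>(x, y). ?\<sigma> x * h (?R x) y) \<in> borel_measurable (lborel \<Otimes>\<^sub>M lborel)"
      using w2 unfolding M_def by auto
    have w3: "integrable M (\<lambda>(x, y). ?\<sigma> (?R x) * h x y)"
      and e3: "(\<integral>(x, y). ?\<sigma> (?R x) * h x y \<partial>M) = (\<integral>(x, y). ?\<sigma> x * h (?R x) y \<partial>M)"
      using integrable_reflection_fst[OF w2m, of k] integral_reflection_fst[OF w2m, of k] w2
      by (simp_all add: M_def)
    have "(\<integral>(x, y). h x y \<partial>M) = (\<integral>w. (case w of (x, y) \<Rightarrow> ?\<sigma> x * h x y) + (case w of (x, y) \<Rightarrow> ?\<sigma> (?R x) * h x y) \<partial>M)"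
      by (rule Bochner_Integration.integral_cong) (auto simp: half_weight_reflection algebra_simps)
    also have "\<dots> = (\<integral>w. (case w of (x, y) \<Rightarrow> ?\<sigma> x * h x y) + (case w of (x, y) \<Rightarrow> ?\<sigma> x * h (?R x) y) \<partial>M)"
      by (simp only: Bochner_Integration.integral_add[OF w1 w3] Bochner_Integration.integral_add[OF w1 w2] e3)
    also have "\<dots> = (\<integral>(x, y). ?\<sigma> x * (h x y + h (?R x) y) \<partial>M)"
      by (rule Bochner_Integration.integral_cong) (auto simp: algebra_simps)
    finally show ?thesis
      using Bochner_Integration.integrable_add[OF w1 w2] by (simp add: case_prod_unfold distrib_left)
  qed
  have snd_fold: "integrable M (\<lambda>(x, y). ?\<sigma> y * (h x y + h x (?R y))) \<and>
     (\<integral>(x, y). h x y \<partial>M) = (\<integral>(x, y). ?\<sigma> y * (h x y + h x (?R y)) \<partial>M)"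
    if h: "integrable M (\<lambda>(x, y). h x y)" for h :: "real ^ 'n \<Rightarrow> real ^ 'n \<Rightarrow> real"
  proof -
    note w1 = weighted(2)[OF h]
    have hm: "(\<lambda>(x, y). h x y) \<in> borel_measurable (lborel \<Otimes>\<^sub>M lborel)" using h unfolding M_def by auto
    have hR: "integrable M (\<lambda>(x, y). h x (?R y))"
      using integrable_reflection_snd[OF hm, of k] h by (simp add: M_def)
    note w2 = weighted(2)[OF hR]
    have w2m: "(\<lambda>(x, y). ?\<sigma> y * h x (?R y)) \<in> borel_measurable (lborel \<Otimes>\<^sub>M lborel)"
      using w2 unfolding M_def by auto
    have w3: "integrable M (\<lambda>(x, y). ?\<sigma> (?R y) * h x y)"
      and e3: "(\<integral>(x, y). ?\<sigma> (?R y) * h x y \<partial>M) = (\<integral>(x, y). ?\<sigma> y * h x (?R y) \<partial>M)"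
      using integrable_reflection_snd[OF w2m, of k] integral_reflection_snd[OF w2m, of k] w2
      by (simp_all add: M_def)
    have "(\<integral>(x, y). h x y \<partial>M) = (\<integral>w. (case w of (x, y) \<Rightarrow> ?\<sigma> y * h x y) + (case w of (x, y) \<Rightarrow> ?\<sigma> (?R y) * h x y) \<partial>M)"
      by (rule Bochner_Integration.integral_cong) (auto simp: half_weight_reflection algebra_simps)
    also have "\<dots> = (\<integral>w. (case w of (x, y) \<Rightarrow> ?\<sigma> y * h x y) + (case w of (x, y) \<Rightarrow> ?\<sigma> y * h x (?R y)) \<partial>M)"
      by (simp only: Bochner_Integration.integral_add[OF w1 w3] Bochner_Integration.integral_add[OF w1 w2] e3)
    also have "\<dots> = (\<integral>(x, y). ?\<sigma> y * (h x y + h x (?R y)) \<partial>M)"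
      by (rule Bochner_Integration.integral_cong) (auto simp: algebra_simps)
    finally show ?thesis
      using Bochner_Integration.integrable_add[OF w1 w2] by (simp add: case_prod_unfold distrib_left)
  qed
  have eq: "?\<sigma> y * (?\<sigma> x * (g x y + g (?R x) y) + ?\<sigma> x * (g x (?R y) + g (?R x) (?R y))) =
    ?\<sigma> x * ?\<sigma> y * (g x y + g (?R x) y + g x (?R y) + g (?R x) (?R y))" for x y
    by (simp add: algebra_simps)
  show ?A ?B
    using fst_fold[OF g] snd_fold[of "\<lambda>x y. ?\<sigma> x * (g x y + g (?R x) y)"] unfolding eq by simp_all
qed

section \<open>The comparison profile\<close>

text \<open>
  The graph of the convex function \<open>t \<mapsto> (max 0 t)\<^sup>2\<close> lies above its tangents.
\<close>

lemma sq_pos_part_ge_tangent: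
  fixes a b :: real
  shows "(max 0 a)\<^sup>2 + 2 * max 0 a * (b - a) \<le> (max 0 b)\<^sup>2"
proof -
  have sq: "0 \<le> (b - a)\<^sup>2" by simp
  show ?thesis
  proof (cases "0 < a \<and> b < 0")
    case True
    have "a * b \<le> 0" using True by (simp add: mult_nonneg_nonpos)
    then show ?thesis using True by (simp add: max_def power2_eq_square algebra_simps)
  next
    case False
    then show ?thesis using sq by (auto simp: max_def power2_eq_square algebra_simps)
  qed
qed

lemma sq_pos_part_lipschitz:
  fixes a b :: real
  assumes "a \<le> 1" "b \<le> 1"
  shows "\<bar>(max 0 a)\<^sup>2 - (max 0 b)\<^sup>2\<bar> \<le> 2 * \<bar>a - b\<bar>"
proof -
  have "\<bar>(max 0 a)\<^sup>2 - (max 0 b)\<^sup>2\<bar> = \<bar>max 0 a + max 0 b\<bar> * \<bar>max 0 a - max 0 b\<bar>"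
    by (simp only: power2_eq_square abs_mult[symmetric] square_diff_square_factored)
  also have "\<dots> \<le> 2 * \<bar>a - b\<bar>"
    using assms by (intro mult_mono) auto
  finally show ?thesis .
qed

text \<open>
  The square makes the truncation at the unit sphere differentiable with Lipschitz derivative,
  which is the regularity that second differences of order \<open>|z|\<^sup>2\<close> require.
\<close>

definition bump :: "'a::euclidean_space \<Rightarrow> real" where
  "bump x = (max 0 (1 - (norm x)\<^sup>2))\<^sup>2"

lemma bump_nonneg: "0 \<le> bump x"
  by (simp add: bump_def)

lemma bump_le_1: "bump x \<le> 1"
  unfolding bump_def by (intro power_le_one) auto

lemma bump_eq_0: "1 \<le> norm x \<Longrightarrow> bump x = 0"
  by (auto simp: bump_def max_def power_le_one_iff dest: one_le_power[of _ 2])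

text \<open>
  In terms of squared norms, so that \<open>norm_diff_reflection_sq\<close> can be used to compare the values
  at a point and at its reflection.
\<close>

lemma bump_diff_le: "\<bar>bump x - bump y\<bar> \<le> 2 * \<bar>(norm x)\<^sup>2 - (norm y)\<^sup>2\<bar>"
  using sq_pos_part_lipschitz[of "1 - (norm x)\<^sup>2" "1 - (norm y)\<^sup>2"]
  by (simp add: bump_def abs_minus_commute)

text \<open>
  By convexity of \<open>t \<mapsto> (max 0 t)\<^sup>2\<close> the right side is controlled by the second
  difference of \<open>1 - |x|\<^sup>2\<close>, which is the constant \<open>- 2 |z|\<^sup>2\<close> by the parallelogram law.
\<close>

lemma bump_second_difference_ge:
  "- 4 * (norm z)\<^sup>2 \<le> bump (x + z) + bump (x - z) - 2 * bump x"
proof -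
  let ?a = "1 - (norm x)\<^sup>2" and ?b = "1 - (norm (x + z))\<^sup>2" and ?c = "1 - (norm (x - z))\<^sup>2"
  have par: "?b + ?c - 2 * ?a = - 2 * (norm z)\<^sup>2"
    by (simp add: power2_norm_eq_inner inner_add_left inner_add_right inner_diff_left
        inner_diff_right algebra_simps)
  have "2 * max 0 ?a * (?b + ?c - 2 * ?a) \<le> bump (x + z) + bump (x - z) - 2 * bump x"
    using sq_pos_part_ge_tangent[of ?a ?b] sq_pos_part_ge_tangent[of ?a ?c]
    by (simp add: bump_def algebra_simps)
  moreover have "max 0 ?a * (norm z)\<^sup>2 \<le> 1 * (norm z)\<^sup>2"
    by (intro mult_right_mono) auto
  ultimately show ?thesis unfolding par by simp
qed

lemma bump_lipschitz: "\<bar>bump x - bump y\<bar> \<le> 4 * norm (x - y)"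
proof -
  \<comment> \<open>The bump depends only on the norm capped at \<open>1\<close>, and on \<open>[0, 1]\<close> squaring has Lipschitz constant
    \<open>2\<close>.\<close>
  define a where "a = min 1 (norm x)"
  define b where "b = min 1 (norm y)"
  have ex: "bump x = (max 0 (1 - a\<^sup>2))\<^sup>2" and ey: "bump y = (max 0 (1 - b\<^sup>2))\<^sup>2"
    unfolding a_def b_def by (auto simp: bump_def min_def max_def power_le_one_iff)
  have ab: "0 \<le> a" "a \<le> 1" "0 \<le> b" "b \<le> 1" by (auto simp: a_def b_def)
  have "\<bar>bump x - bump y\<bar> \<le> 2 * \<bar>a\<^sup>2 - b\<^sup>2\<bar>"
    unfolding ex ey using sq_pos_part_lipschitz[of "1 - a\<^sup>2" "1 - b\<^sup>2"] by (simp add: abs_minus_commute)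
  also have "\<bar>a\<^sup>2 - b\<^sup>2\<bar> = (a + b) * \<bar>a - b\<bar>"
    using ab by (simp add: power2_eq_square abs_mult square_diff_square_factored)
  also have "\<dots> \<le> 2 * \<bar>a - b\<bar>" using ab by (intro mult_right_mono) auto
  also have "\<bar>a - b\<bar> \<le> \<bar>norm x - norm y\<bar>" unfolding a_def b_def by auto
  also have "\<dots> \<le> norm (x - y)" by (rule norm_triangle_ineq3)
  finally show ?thesis by simp
qed

lemma continuous_on_bump: "continuous_on S bump"
  unfolding bump_def[abs_def] by (intro continuous_intros)

definition profile :: "'n::finite \<Rightarrow> real ^ 'n \<Rightarrow> real" where
  "profile k x = x $ k * bump x"

lemma continuous_on_profile: "continuous_on S (profile k)"
  unfolding profile_def[abs_def] by (intro continuous_intros continuous_on_bump)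

lemma profile_measurable [measurable]: "profile k \<in> borel_measurable borel"
  by (intro borel_measurable_continuous_onI continuous_on_profile)

lemma profile_reflection: "profile k (reflection k x) = - profile k x"
  by (simp add: profile_def bump_def)

lemma profile_eq_0: "1 \<le> norm x \<Longrightarrow> profile k x = 0"
  by (simp add: profile_def bump_eq_0)

lemma profile_le: "0 \<le> x $ k \<Longrightarrow> profile k x \<le> x $ k"
  unfolding profile_def using mult_left_mono[OF bump_le_1] by fastforce

lemma profile_nonneg: "0 \<le> x $ k \<Longrightarrow> 0 \<le> profile k x"
  unfolding profile_def by (simp add: bump_nonneg)

lemma abs_profile_le_1: "\<bar>profile k x\<bar> \<le> 1"
proof (cases "norm x \<le> 1")
  case True
  have "\<bar>profile k x\<bar> = \<bar>x $ k\<bar> * bump x" by (simp add: profile_def abs_mult bump_nonneg)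
  also have "\<dots> \<le> 1 * 1"
    using component_le_norm_cart[of x k] True by (intro mult_mono bump_le_1 bump_nonneg) auto
  finally show ?thesis by simp
qed (simp add: profile_eq_0)

lemma profile_lipschitz: "\<bar>profile k x - profile k y\<bar> \<le> 5 * norm (x - y)"
proof -
  have *: "\<bar>profile k x - profile k y\<bar> \<le> 5 * norm (x - y)" if "norm y \<le> 1" for x y
  proof -
    have "profile k x - profile k y = (x - y) $ k * bump x + y $ k * (bump x - bump y)"
      by (simp add: profile_def algebra_simps)
    then have "\<bar>profile k x - profile k y\<bar> \<le> \<bar>(x - y) $ k\<bar> * bump x + \<bar>y $ k\<bar> * \<bar>bump x - bump y\<bar>"
      by (metis abs_mult abs_of_nonneg abs_triangle_ineq bump_nonneg)
    also have "\<dots> \<le> norm (x - y) * 1 + 1 * (4 * norm (x - y))"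
      using component_le_norm_cart[of y k] that
      by (intro add_mono mult_mono component_le_norm_cart bump_le_1 bump_nonneg bump_lipschitz) auto
    finally show ?thesis by simp
  qed
  consider "norm y \<le> 1" | "norm x \<le> 1" | "1 \<le> norm x" "1 \<le> norm y" by linarith
  then show ?thesis
    by cases (use *[of y x] *[of x y] in \<open>auto simp: profile_eq_0 norm_minus_commute abs_minus_commute\<close>)
qed

text \<open>
  A single second difference of an odd function need not vanish on the hyperplane, but its average
  over \<open>z\<close> and \<open>R z\<close> is odd in \<open>x\<^sub>k\<close> and does. Writing \<open>\<psi> = x\<^sub>k \<eta>\<close> with \<open>\<eta>\<close> the bump, the sum splits
  into \<open>x\<^sub>k\<close> times second differences of \<open>\<eta>\<close> and \<open>z\<^sub>k\<close> times differences of \<open>\<eta>\<close> between points whose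
  squared norms differ by \<open>4 x\<^sub>k z\<^sub>k\<close>; both parts carry the factor \<open>x\<^sub>k\<close>.
\<close>

lemma profile_averaged_second_difference_ge:
  assumes x: "norm x \<le> 1" "0 \<le> x $ k"
  shows "- (68 * x $ k * min 1 ((norm z)\<^sup>2)) \<le>
    profile k (x + z) + profile k (x - z) + profile k (x + reflection k z) + profile k (x - reflection k z)
      - 4 * profile k x"
proof -
  let ?R = "reflection k z" and ?N = "(norm z)\<^sup>2"
  let ?A = "bump (x + z) + bump (x - z) - 2 * bump x + (bump (x + ?R) + bump (x - ?R) - 2 * bump x)"
  let ?B = "z $ k * (bump (x + z) - bump (x + ?R)) + z $ k * (bump (x - ?R) - bump (x - z))"
  have eq: "profile k (x + z) + profile k (x - z) + profile k (x + ?R) + profile k (x - ?R)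
      - 4 * profile k x = x $ k * ?A + ?B"
    by (simp add: profile_def algebra_simps)
  have A1: "- 8 * ?N \<le> ?A"
    using bump_second_difference_ge[of z x] bump_second_difference_ge[of ?R x] by simp
  have A2: "- 4 \<le> ?A"
    using bump_nonneg[of "x + z"] bump_nonneg[of "x - z"] bump_nonneg[of "x + ?R"]
      bump_nonneg[of "x - ?R"] bump_le_1[of x] by linarith
  have zk: "\<bar>z $ k\<bar> \<le> norm z" by (rule component_le_norm_cart)
  have nR: "(norm (x - ?R))\<^sup>2 = (norm (x - z))\<^sup>2 + 4 * x $ k * z $ k"
    by (rule norm_diff_reflection_sq)
  have nR': "(norm (x + ?R))\<^sup>2 = (norm (x + z))\<^sup>2 - 4 * x $ k * z $ k"
    using norm_diff_reflection_sq[of x k "- z"] by (simp add: reflection_minus)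
  have d1: "\<bar>bump (x + z) - bump (x + ?R)\<bar> \<le> 8 * (x $ k * \<bar>z $ k\<bar>)"
    using bump_diff_le[of "x + z" "x + ?R"] x unfolding nR' by (simp add: abs_mult)
  have d2: "\<bar>bump (x - ?R) - bump (x - z)\<bar> \<le> 8 * (x $ k * \<bar>z $ k\<bar>)"
    using bump_diff_le[of "x - ?R" "x - z"] x unfolding nR by (simp add: abs_mult)
  have z2: "\<bar>z $ k\<bar> * \<bar>z $ k\<bar> \<le> ?N"
    unfolding power2_eq_square using zk by (intro mult_mono) auto
  have absB: "\<bar>?B\<bar> \<le> 16 * (x $ k * ?N)"
  proof -
    have "\<bar>?B\<bar> \<le> \<bar>z $ k\<bar> * \<bar>bump (x + z) - bump (x + ?R)\<bar> + \<bar>z $ k\<bar> * \<bar>bump (x - ?R) - bump (x - z)\<bar>"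
      by (simp only: abs_mult[symmetric] abs_triangle_ineq)
    also have "\<dots> \<le> \<bar>z $ k\<bar> * (8 * (x $ k * \<bar>z $ k\<bar>)) + \<bar>z $ k\<bar> * (8 * (x $ k * \<bar>z $ k\<bar>))"
      by (intro add_mono mult_left_mono d1 d2) auto
    also have "\<dots> = 16 * (x $ k * (\<bar>z $ k\<bar> * \<bar>z $ k\<bar>))" by simp
    also have "\<dots> \<le> 16 * (x $ k * ?N)"
      by (intro mult_left_mono z2 x) simp
    finally show ?thesis .
  qed
  show ?thesis
  proof (cases "norm z \<le> 1")
    case True
    have N1: "?N \<le> 1" using True by (simp add: power_le_one)
    have "x $ k * (- 8 * ?N) \<le> x $ k * ?A" by (intro mult_left_mono A1 x)
    then have "- (24 * (x $ k * ?N)) \<le> x $ k * ?A + ?B" using absB by (simp only: abs_le_iff) linarith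
    moreover have "0 \<le> x $ k * ?N" using x by simp
    ultimately have "- (68 * (x $ k * ?N)) \<le> x $ k * ?A + ?B" by linarith
    then show ?thesis unfolding eq using N1 by (simp add: min_absorb2 mult.assoc)
  next
    case z1: False
    have A3: "x $ k * (- 4) \<le> x $ k * ?A" by (intro mult_left_mono A2 x)
    have "- (64 * x $ k) \<le> ?B"
    proof (cases "norm z \<le> 2")
      case True
      have "x $ k * ?N \<le> x $ k * 2\<^sup>2" using x True by (intro mult_left_mono power_mono) auto
      then have "x $ k * ?N \<le> 4 * x $ k" by simp
      then show ?thesis using absB by (simp only: abs_le_iff) linarith
    next
      case False
      \<comment> \<open>All four shifted points are outside the unit ball.\<close>
      have far: "1 \<le> norm (x + y)" if "norm y = norm z" for y
        using norm_triangle_ineq4[of "x + y" x] that x False by simp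
      have "?B = 0"
        using far[of z] far[of "- z"] far[of ?R] far[of "- ?R"] by (simp add: bump_eq_0)
      then show ?thesis using x by simp
    qed
    then have "- (68 * x $ k) \<le> x $ k * ?A + ?B" using A3 by linarith
    moreover have "1 \<le> ?N" using z1 by (simp add: one_le_power)
    ultimately show ?thesis unfolding eq by (simp add: min_absorb1)
  qed
qed

section \<open>The energy form and the profile\<close>

definition energy_density ::
  "real \<Rightarrow> ('a::euclidean_space \<Rightarrow> real) \<Rightarrow> ('a \<Rightarrow> real) \<Rightarrow> 'a \<Rightarrow> 'a \<Rightarrow> real" where
  "energy_density p f g x y = (f x - f y) * (g x - g y) / norm (x - y) powr p"

definition finite_energy :: "real \<Rightarrow> ('a::euclidean_space \<Rightarrow> real) \<Rightarrow> bool" where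
  "finite_energy p f \<longleftrightarrow> integrable (lborel \<Otimes>\<^sub>M lborel) (\<lambda>(x, y). energy_density p f f x y)"

definition energy_form ::
  "real \<Rightarrow> ('a::euclidean_space \<Rightarrow> real) \<Rightarrow> ('a \<Rightarrow> real) \<Rightarrow> real" where
  "energy_form p f g = (\<integral>(x, y). energy_density p f g x y \<partial>(lborel \<Otimes>\<^sub>M lborel))"

lemma energy_density_measurable [measurable]:
  assumes [measurable]: "f \<in> borel_measurable borel" "g \<in> borel_measurable borel"
  shows "(\<lambda>(x, y). energy_density p f g x y) \<in> borel_measurable (lborel \<Otimes>\<^sub>M lborel)"
  unfolding energy_density_def by measurable

lemma energy_density_self: "energy_density p f f x y = (f x - f y)\<^sup>2 / norm (x - y) powr p"
  by (simp add: energy_density_def power2_eq_square)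

lemma energy_density_self_nonneg: "0 \<le> energy_density p f f x y"
  by (simp add: energy_density_self)

lemma abs_energy_density_le:
  "\<bar>energy_density p f g x y\<bar> \<le> energy_density p f f x y + energy_density p g g x y"
proof -
  have "\<bar>a * b\<bar> \<le> a\<^sup>2 + b\<^sup>2" for a b :: real
  proof -
    have "2 * (\<bar>a\<bar> * \<bar>b\<bar>) \<le> a\<^sup>2 + b\<^sup>2" using sum_squares_bound[of "\<bar>a\<bar>" "\<bar>b\<bar>"] by simp
    moreover have "0 \<le> \<bar>a\<bar> * \<bar>b\<bar>" by simp
    ultimately show ?thesis unfolding abs_mult by linarith
  qed
  then have "\<bar>(f x - f y) * (g x - g y)\<bar> / norm (x - y) powr p \<le>
      ((f x - f y)\<^sup>2 + (g x - g y)\<^sup>2) / norm (x - y) powr p"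
    by (intro divide_right_mono) auto
  then show ?thesis
    unfolding energy_density_self by (simp add: energy_density_def add_divide_distrib)
qed

lemma integrable_energy_density:
  assumes [measurable]: "f \<in> borel_measurable borel" "g \<in> borel_measurable borel"
    and f: "finite_energy p f" and g: "finite_energy p g"
  shows "integrable (lborel \<Otimes>\<^sub>M lborel) (\<lambda>(x, y). energy_density p f g x y)"
proof (rule Bochner_Integration.integrable_bound)
  show "integrable (lborel \<Otimes>\<^sub>M lborel) (\<lambda>w. (case w of (x, y) \<Rightarrow> energy_density p f f x y) +
      (case w of (x, y) \<Rightarrow> energy_density p g g x y))"
    using f g unfolding finite_energy_def by (rule Bochner_Integration.integrable_add)
  show "AE w in lborel \<Otimes>\<^sub>M lborel. norm (case w of (x, y) \<Rightarrow> energy_density p f g x y) \<le>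
      norm ((case w of (x, y) \<Rightarrow> energy_density p f f x y) + (case w of (x, y) \<Rightarrow> energy_density p g g x y))"
    by (rule always_eventually)
      (auto intro!: order_trans[OF abs_energy_density_le] simp: energy_density_self_nonneg)
qed measurable

lemma finite_energy_diff:
  assumes [measurable]: "f \<in> borel_measurable borel" "g \<in> borel_measurable borel"
    and f: "finite_energy p f" and g: "finite_energy p g"
  shows "finite_energy p (\<lambda>x. d * f x - g x)"
proof -
  have "energy_density p (\<lambda>x. d * f x - g x) (\<lambda>x. d * f x - g x) x y =
     d\<^sup>2 * energy_density p f f x y - 2 * d * energy_density p f g x y + energy_density p g g x y" for x y
    unfolding energy_density_def
    by (simp add: add_divide_distrib[symmetric] diff_divide_distrib[symmetric] power2_eq_square) (simp add: algebra_simps)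
  then show ?thesis
    using integrable_energy_density[OF assms] f g
    unfolding finite_energy_def case_prod_unfold by simp
qed

lemma energy_form_diff:
  assumes [measurable]: "f \<in> borel_measurable borel" "g \<in> borel_measurable borel" "v \<in> borel_measurable borel"
    and f: "finite_energy p f" and g: "finite_energy p g" and v: "finite_energy p v"
  shows "energy_form p (\<lambda>x. d * f x - g x) v = d * energy_form p f v - energy_form p g v"
proof -
  have "energy_density p (\<lambda>x. d * f x - g x) v x y =
     d * energy_density p f v x y - energy_density p g v x y" for x y
    unfolding energy_density_def
    by (simp add: diff_divide_distrib[symmetric]) (simp add: algebra_simps)
  then show ?thesis
    using integrable_energy_density[OF assms(1,3) f v] integrable_energy_density[OF assms(2,3) g v]
    unfolding energy_form_def case_prod_unfold by simp
qed

text \<open>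
  The integrand is at most a multiple of the truncated kernel in \<open>x - y\<close> and vanishes unless \<open>x\<close> or
  \<open>y\<close> lies in the bounded support; a shear turns the bound into a product of integrable functions.
\<close>

lemma finite_energy_lipschitz:
  fixes f :: "'a::euclidean_space \<Rightarrow> real"
  assumes s: "0 < s" "s < 1" and p: "p = real DIM('a) + 2 * s"
    and [measurable]: "f \<in> borel_measurable borel"
    and lip: "\<And>x y. \<bar>f x - f y\<bar> \<le> L * norm (x - y)"
    and bounded: "\<And>x. \<bar>f x\<bar> \<le> L"
    and supp: "\<And>x. r \<le> norm x \<Longrightarrow> f x = 0"
  shows "finite_energy p f"
proof -
  let ?k = "\<lambda>z::'a. min 1 ((norm z)\<^sup>2) / norm z powr p"
  let ?I = "indicator (ball 0 r) :: 'a \<Rightarrow> real"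
  have [measurable]: "ball 0 r \<in> sets (borel :: 'a measure)" by simp
  have L: "0 \<le> L" using bounded[of 0] by linarith
  have I: "integrable lborel ?I"
    by (intro integrable_real_indicator emeasure_lborel_ball_finite) simp
  have "integrable (lborel \<Otimes>\<^sub>M lborel) (\<lambda>(x, z). ?I x * ?k z)"
    by (rule integrable_product_fun[OF I integrable_truncated_kernel[OF s p]])
  moreover have m: "(\<lambda>(x, y). ?I x * ?k (x - y)) \<in> borel_measurable (lborel \<Otimes>\<^sub>M lborel)"
    by measurable
  ultimately have i1: "integrable (lborel \<Otimes>\<^sub>M lborel) (\<lambda>(x, y). ?I x * ?k (x - y))"
    using integrable_shear[OF m] by simp
  then have i2: "integrable (lborel \<Otimes>\<^sub>M lborel) (\<lambda>(x, y). ?I y * ?k (y - x))"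
    using lborel_pair.integrable_product_swap[OF i1] by simp
  have sq: "(f x - f y)\<^sup>2 \<le> 4 * L\<^sup>2 * ((?I x + ?I y) * min 1 ((norm (x - y))\<^sup>2))" for x y
  proof (cases "norm x < r \<or> norm y < r")
    case True
    then have I1: "1 \<le> ?I x + ?I y" by (auto simp: indicator_def)
    have a1: "\<bar>f x - f y\<bar> \<le> 2 * L * norm (x - y)" 
      using lip[of x y] L mult_nonneg_nonneg[OF L norm_ge_zero[of "x - y"]] by linarith
    have a2: "\<bar>f x - f y\<bar> \<le> 2 * L * 1" using bounded[of x] bounded[of y] by linarith
    have "\<bar>f x - f y\<bar> \<le> 2 * L * min 1 (norm (x - y))"
      using a1 a2 by (auto simp: min_def)
    then have "\<bar>f x - f y\<bar>\<^sup>2 \<le> (2 * L * min 1 (norm (x - y)))\<^sup>2"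
      by (rule power_mono) simp
    also have "\<dots> = 4 * L\<^sup>2 * (min 1 (norm (x - y)))\<^sup>2" by (simp add: power_mult_distrib)
    also have "(min 1 (norm (x - y)))\<^sup>2 \<le> min 1 ((norm (x - y))\<^sup>2)"
      by (auto simp: min_def power_le_one_iff)
    also have "\<dots> \<le> (?I x + ?I y) * min 1 ((norm (x - y))\<^sup>2)"
      using mult_right_mono[OF I1, of "min 1 ((norm (x - y))\<^sup>2)"] by simp
    finally show ?thesis using L by (simp add: mult_left_mono)
  next
    case False
    then show ?thesis using supp[of x] supp[of y] by simp
  qed
  have "integrable (lborel \<Otimes>\<^sub>M lborel) (\<lambda>w. 4 * L\<^sup>2 * ((case w of (x, y) \<Rightarrow> ?I x * ?k (x - y)) +
      (case w of (x, y) \<Rightarrow> ?I y * ?k (y - x))))"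
    by (intro integrable_mult_right Bochner_Integration.integrable_add i1 i2)
  then show ?thesis
    unfolding finite_energy_def
  proof (rule Bochner_Integration.integrable_bound)
    show "AE w in lborel \<Otimes>\<^sub>M lborel. norm (case w of (x, y) \<Rightarrow> energy_density p f f x y) \<le>
       norm (4 * L\<^sup>2 * ((case w of (x, y) \<Rightarrow> ?I x * ?k (x - y)) + (case w of (x, y) \<Rightarrow> ?I y * ?k (y - x))))"
    proof (intro always_eventually allI)
      fix w :: "'a \<times> 'a"
      obtain x y where w: "w = (x, y)" by (cases w)
      have "energy_density p f f x y \<le>
          4 * L\<^sup>2 * ((?I x + ?I y) * min 1 ((norm (x - y))\<^sup>2)) / norm (x - y) powr p"
        unfolding energy_density_self by (intro divide_right_mono sq) simp
      also have "\<dots> = 4 * L\<^sup>2 * (?I x * ?k (x - y) + ?I y * ?k (y - x))"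
        by (simp add: norm_minus_commute algebra_simps add_divide_distrib)
      finally have le: "energy_density p f f x y \<le> 4 * L\<^sup>2 * (?I x * ?k (x - y) + ?I y * ?k (y - x))" .
      then show "norm (case w of (x, y) \<Rightarrow> energy_density p f f x y) \<le>
         norm (4 * L\<^sup>2 * ((case w of (x, y) \<Rightarrow> ?I x * ?k (x - y)) + (case w of (x, y) \<Rightarrow> ?I y * ?k (y - x))))"
        using order_trans[OF le abs_ge_self] by (simp add: w energy_density_self_nonneg)
    qed
  qed measurable
qed

lemma finite_energy_profile:
  assumes "0 < s" "s < 1" "p = real CARD('n) + 2 * s"
  shows "finite_energy p (profile (k :: 'n::finite))"
proof (rule finite_energy_lipschitz[where L = 5 and r = 1 and s = s])
  show "\<bar>profile k x\<bar> \<le> 5" for x using abs_profile_le_1[of k x] by simp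
qed (use assms in \<open>simp_all add: profile_lipschitz profile_eq_0\<close>)

lemma
  fixes h :: "'a::euclidean_space \<Rightarrow> real"
  assumes "integrable lborel h"
  shows integrable_translate: "integrable lborel (\<lambda>x. h (x + z))"
    and integral_translate: "(\<integral>x. h (x + z) \<partial>lborel) = (\<integral>x. h x \<partial>lborel)"
proof -
  have T: "(+) z \<in> lborel \<rightarrow>\<^sub>M borel" and m: "h \<in> borel_measurable borel" using assms by auto
  show "integrable lborel (\<lambda>x. h (x + z))"
    using integrable_distr_eq[OF T m, unfolded lborel_distr_plus] assms by (simp add: add.commute)
  show "(\<integral>x. h (x + z) \<partial>lborel) = (\<integral>x. h x \<partial>lborel)"
    using integral_distr[OF T m, unfolded lborel_distr_plus] by (simp add: add.commute)
qed

text \<open>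
  A discrete integration by parts: in the two terms that contain \<open>v (x + z)\<close> the variable is
  translated by \<open>- z\<close>.
\<close>

lemma
  fixes f v :: "'a::euclidean_space \<Rightarrow> real"
  assumes v: "integrable lborel v" and fm[measurable]: "f \<in> borel_measurable borel"
    and bounded: "\<And>x. \<bar>f x\<bar> \<le> L"
  shows integrable_second_difference: "integrable lborel (\<lambda>x. v x * (2 * f x - f (x + z) - f (x - z)))"
    and integral_difference_product:
      "(\<integral>x. (f x - f (x + z)) * (v x - v (x + z)) \<partial>lborel) =
       (\<integral>x. v x * (2 * f x - f (x + z) - f (x - z)) \<partial>lborel)"
proof -
  have vm[measurable]: "v \<in> borel_measurable borel" using v by auto
  have prod: "integrable lborel (\<lambda>x. f (x + a) * v (x + b))" for a b
  proof (rule Bochner_Integration.integrable_bound)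
    show "integrable lborel (\<lambda>x. L * v (x + b))"
      by (intro integrable_mult_right integrable_translate v)
    show "AE x in lborel. norm (f (x + a) * v (x + b)) \<le> norm (L * v (x + b))"
      by (intro always_eventually allI) (auto simp: abs_mult intro!: mult_right_mono order_trans[OF bounded])
  qed measurable
  note p00 = prod[of 0 0, simplified] and p10 = prod[of z 0, simplified]
    and p01 = prod[of 0 z, simplified] and p11 = prod[of z z] and pm0 = prod[of "- z" 0, simplified]
  show "integrable lborel (\<lambda>x. v x * (2 * f x - f (x + z) - f (x - z)))"
  proof -
    have "integrable lborel (\<lambda>x. 2 * (f x * v x) - f (x + z) * v x - f (x - z) * v x)"
      using p00 p10 pm0 by simp
    then show ?thesis by (rule back_subst[of "integrable lborel"]) (auto simp: algebra_simps)
  qed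
  have e01: "(\<integral>x. f x * v (x + z) \<partial>lborel) = (\<integral>x. f (x - z) * v x \<partial>lborel)"
    using integral_translate[OF pm0, of z] by simp
  have e11: "(\<integral>x. f (x + z) * v (x + z) \<partial>lborel) = (\<integral>x. f x * v x \<partial>lborel)"
    by (rule integral_translate[OF p00])
  have "(\<integral>x. (f x - f (x + z)) * (v x - v (x + z)) \<partial>lborel) =
     (\<integral>x. f x * v x - f (x + z) * v x - f x * v (x + z) + f (x + z) * v (x + z) \<partial>lborel)"
    by (rule Bochner_Integration.integral_cong) (auto simp: algebra_simps)
  also have "\<dots> = (\<integral>x. f x * v x \<partial>lborel) - (\<integral>x. f (x + z) * v x \<partial>lborel)
      - (\<integral>x. f x * v (x + z) \<partial>lborel) + (\<integral>x. f (x + z) * v (x + z) \<partial>lborel)"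
    using p00 p10 p01 p11 by simp
  also have "\<dots> = 2 * (\<integral>x. f x * v x \<partial>lborel) - (\<integral>x. f (x + z) * v x \<partial>lborel) - (\<integral>x. f (x - z) * v x \<partial>lborel)"
    by (simp add: e01 e11)
  also have "\<dots> = (\<integral>x. 2 * (f x * v x) - f (x + z) * v x - f (x - z) * v x \<partial>lborel)"
    using p00 p10 pm0 by simp
  also have "\<dots> = (\<integral>x. v x * (2 * f x - f (x + z) - f (x - z)) \<partial>lborel)"
    by (rule Bochner_Integration.integral_cong) (auto simp: algebra_simps)
  finally show "(\<integral>x. (f x - f (x + z)) * (v x - v (x + z)) \<partial>lborel) =
       (\<integral>x. v x * (2 * f x - f (x + z) - f (x - z)) \<partial>lborel)" .
qed

text \<open>
  For fixed \<open>z\<close> the inner integral pairs \<open>v\<close> with a second difference of the profile. The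
  outer integral does not change under \<open>z \<mapsto> R z\<close>, so the second difference may be averaged over \<open>z\<close>
  and \<open>R z\<close>, which is where the factor \<open>x\<^sub>k\<close> appears.
\<close>

lemma energy_form_profile_le:
  fixes v :: "real ^ 'n::finite \<Rightarrow> real" and k :: 'n
  assumes s: "0 < s" "s < 1" and p: "p = real CARD('n) + 2 * s"
    and v: "integrable lborel v" "finite_energy p v"
    and nonneg: "\<And>x. 0 \<le> v x" and supp: "\<And>x. x \<notin> half_ball k \<Longrightarrow> v x = 0"
    and xv: "integrable lborel (\<lambda>x. x $ k * v x)"
  shows "energy_form p (profile k) v \<le>
    34 * (\<integral>z. min 1 ((norm (z :: real ^ 'n))\<^sup>2) / norm z powr p \<partial>lborel) * (\<integral>x. x $ k * v x \<partial>lborel)"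
proof -
  let ?M = "lborel \<Otimes>\<^sub>M lborel :: ((real ^ 'n) \<times> (real ^ 'n)) measure"
  let ?R = "reflection k"
  let ?f = "profile k"
  let ?k = "\<lambda>z::real ^ 'n. min 1 ((norm z)\<^sup>2) / norm z powr p"
  let ?X = "\<integral>x. x $ k * v x \<partial>lborel"
  have [measurable]: "v \<in> borel_measurable borel" using v by auto
  define D where "D z x = 2 * ?f x - ?f (x + z) - ?f (x - z)" for z x
  define J where "J z = (\<integral>x. v x * D z x \<partial>lborel) / norm z powr p" for z
  have vD: "integrable lborel (\<lambda>x. v x * D z x)" for z
    unfolding D_def by (rule integrable_second_difference[OF v(1) profile_measurable abs_profile_le_1])
  have i: "integrable ?M (\<lambda>(x, y). energy_density p ?f v x y)"
    by (rule integrable_energy_density) (use finite_energy_profile[OF s p] v in auto)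
  then have m: "(\<lambda>(x, y). energy_density p ?f v x y) \<in> borel_measurable ?M" by auto
  have ish: "integrable ?M (\<lambda>(x, z). energy_density p ?f v x (x + z))"
    using integrable_shear[OF m] i by simp
  have Jeq: "(\<integral>x. energy_density p ?f v x (x + z) \<partial>lborel) = J z" for z
    using integral_difference_product[where f = ?f and z = z, OF v(1) profile_measurable abs_profile_le_1]
    unfolding J_def D_def energy_density_def by simp
  have Jint: "integrable lborel J"
    using lborel_pair.integrable_snd[OF ish] by (simp add: Jeq)
  have e1: "energy_form p ?f v = (\<integral>z. J z \<partial>lborel)"
    using integral_shear[OF m] lborel_pair.integral_snd[OF ish]
    by (simp add: energy_form_def Jeq)
  have R: "?R \<in> lborel \<rightarrow>\<^sub>M borel" by measurable
  have Jm: "J \<in> borel_measurable borel" using Jint by auto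
  \<comment> \<open>\<open>J (R z)\<close> has the same integral as \<open>J z\<close>, and only their sum is controlled by \<open>x\<^sub>k\<close>.\<close>
  have JR: "integrable lborel (\<lambda>z. J (?R z))" "(\<integral>z. J (?R z) \<partial>lborel) = (\<integral>z. J z \<partial>lborel)"
    using integrable_distr_eq[OF R Jm, unfolded distr_reflection]
      integral_distr[OF R Jm, unfolded distr_reflection] Jint by simp_all
  have le: "J z + J (?R z) \<le> 68 * ?X * ?k z" for z
  proof -
    have "(\<integral>x. v x * D z x \<partial>lborel) + (\<integral>x. v x * D (?R z) x \<partial>lborel) =
        (\<integral>x. v x * D z x + v x * D (?R z) x \<partial>lborel)"
      using vD by simp
    also have "\<dots> \<le> (\<integral>x. (68 * min 1 ((norm z)\<^sup>2)) * (x $ k * v x) \<partial>lborel)"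
    proof (rule integral_mono)
      fix x
      show "v x * D z x + v x * D (?R z) x \<le> (68 * min 1 ((norm z)\<^sup>2)) * (x $ k * v x)"
      proof (cases "x \<in> half_ball k")
        case True
        then have "norm x \<le> 1" "0 \<le> x $ k" by (auto simp: half_ball_def half_space_def)
        from profile_averaged_second_difference_ge[OF this, of z]
        have "D z x + D (?R z) x \<le> 68 * x $ k * min 1 ((norm z)\<^sup>2)"
          by (simp add: D_def)
        from mult_left_mono[OF this nonneg[of x]] show ?thesis by (simp add: algebra_simps)
      qed (simp add: supp)
    qed (use vD xv in auto)
    also have "\<dots> = 68 * min 1 ((norm z)\<^sup>2) * ?X" using xv by simp
    finally have "((\<integral>x. v x * D z x \<partial>lborel) + (\<integral>x. v x * D (?R z) x \<partial>lborel)) / norm z powr p \<le>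
        68 * min 1 ((norm z)\<^sup>2) * ?X / norm z powr p"
      by (rule divide_right_mono) simp
    then show ?thesis by (simp add: J_def add_divide_distrib mult.commute mult.left_commute)
  qed
  have "2 * energy_form p ?f v = (\<integral>z. J z + J (?R z) \<partial>lborel)"
    using Jint JR e1 by simp
  also have "\<dots> \<le> (\<integral>z. 68 * ?X * ?k z \<partial>lborel)"
    using integrable_truncated_kernel[OF s, where 'a = "real ^ 'n" and p = p] p
    by (intro integral_mono le Bochner_Integration.integrable_add Jint JR integrable_mult_right) simp_all
  also have "\<dots> = 68 * ?X * (\<integral>z. ?k z \<partial>lborel)" by (rule integral_mult_right_zero)
  finally show ?thesis by (simp add: mult_ac)
qed

section \<open>Positive parts of odd functions on the half-space\<close>

definition half_pos_part :: "'n::finite \<Rightarrow> (real ^ 'n \<Rightarrow> real) \<Rightarrow> real ^ 'n \<Rightarrow> real" where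
  "half_pos_part k w x = (if 0 < x $ k then max 0 (w x) else 0)"

lemma half_pos_part_measurable [measurable]:
  assumes [measurable]: "w \<in> borel_measurable borel"
  shows "half_pos_part k w \<in> borel_measurable borel"
  unfolding half_pos_part_def[abs_def] by measurable

lemma half_pos_part_nonneg: "0 \<le> half_pos_part k w x"
  by (simp add: half_pos_part_def)

lemma odd_on_hyperplane:
  fixes w :: "real ^ 'n::finite \<Rightarrow> real"
  assumes odd: "\<And>x. w (reflection k x) = - w x" and "x $ k = 0"
  shows "w x = 0"
proof -
  have "reflection k x = x" using assms(2) by (simp add: vec_eq_iff)
  then show ?thesis using odd[of x] by simp
qed

lemma half_pos_part_of_odd:
  fixes w :: "real ^ 'n::finite \<Rightarrow> real"
  assumes odd: "\<And>x. w (reflection k x) = - w x" and "0 \<le> x $ k"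
  shows "half_pos_part k w x = max 0 (w x)" and "half_pos_part k w (reflection k x) = 0"
proof -
  have "x $ k = 0 \<Longrightarrow> w x = 0" by (rule odd_on_hyperplane[of w k x, OF odd])
  with assms(2) show "half_pos_part k w x = max 0 (w x)"
    by (cases "x $ k = 0") (simp_all add: half_pos_part_def)
  show "half_pos_part k w (reflection k x) = 0"
    using assms(2) by (simp add: half_pos_part_def)
qed

lemma norm_diff_reflection_le:
  assumes "x $ k * y $ k \<le> 0"
  shows "norm (x - reflection k y) \<le> norm (x - y)"
proof (rule power2_le_imp_le)
  have "4 * x $ k * y $ k = 4 * (x $ k * y $ k)" by simp
  then show "(norm (x - reflection k y))\<^sup>2 \<le> (norm (x - y))\<^sup>2"
    using norm_diff_reflection_sq[of x k y] assms by linarith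
qed simp

lemma norm_diff_le_reflection:
  assumes "0 \<le> x $ k * y $ k"
  shows "norm (x - y) \<le> norm (x - reflection k y)"
proof (rule power2_le_imp_le)
  have "4 * x $ k * y $ k = 4 * (x $ k * y $ k)" by simp
  then show "(norm (x - y))\<^sup>2 \<le> (norm (x - reflection k y))\<^sup>2"
    using norm_diff_reflection_sq[of x k y] assms by linarith
qed simp

lemma energy_density_commute: "energy_density p f g x y = energy_density p f g y x"
  unfolding energy_density_def by (simp add: norm_minus_commute algebra_simps)

text \<open>
  The only dangerous case is \<open>x\<close> in the half-space, \<open>y\<close> outside, where truncation replaces \<open>w y\<close>
  by \<open>0\<close> although \<open>w x\<close> and \<open>w y\<close> may both be positive and close to each other. Then oddness makes
  \<open>w (R y)\<close> negative, and \<open>R y\<close> is closer to \<open>x\<close> than \<open>y\<close> is.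
\<close>

lemma energy_density_half_pos_part_le:
  fixes w :: "real ^ 'n::finite \<Rightarrow> real"
  assumes p: "0 \<le> p" and odd: "\<And>x. w (reflection k x) = - w x"
  defines "v \<equiv> half_pos_part k w"
  shows "energy_density p v v x y \<le> energy_density p w w x y + energy_density p w w x (reflection k y)"
proof -
  have mixed: "energy_density p v v x y \<le> energy_density p w w x y + energy_density p w w x (reflection k y)"
    if xy: "0 < x $ k" "y $ k \<le> 0" for x y
  proof -
    have vx: "v x = max 0 (w x)" and vy: "v y = 0" using xy by (auto simp: v_def half_pos_part_def)
    consider "w x \<le> 0" | "0 < w x" "w y \<le> 0" | "0 < w x" "0 < w y" by linarith
    then show ?thesis
    proof cases
      case 1
      then have "energy_density p v v x y = 0" by (simp add: energy_density_self vx vy)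
      then show ?thesis by (simp add: energy_density_self_nonneg)
    next
      case 2
      then have "(v x - v y)\<^sup>2 \<le> (w x - w y)\<^sup>2" unfolding vx vy by (intro power_mono) auto
      then have "energy_density p v v x y \<le> energy_density p w w x y"
        unfolding energy_density_self by (intro divide_right_mono) auto
      then show ?thesis using energy_density_self_nonneg[of p w x "reflection k y"] by linarith
    next
      case 3
      \<comment> \<open>The kernel has the value \<open>0\<close> at coinciding points, so these have to be excluded before the
        kernels are compared.\<close>
      have neq: "x \<noteq> reflection k y" using 3 odd[of y] by auto
      have sq: "(v x - v y)\<^sup>2 \<le> (w x - w (reflection k y))\<^sup>2"
        unfolding vx vy odd using 3 by (intro power_mono) auto
      have nle: "norm (x - reflection k y) \<le> norm (x - y)"
        using xy by (intro norm_diff_reflection_le) (simp add: mult_nonneg_nonpos)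
      have "energy_density p v v x y \<le> energy_density p w w x (reflection k y)"
        unfolding energy_density_self
        using neq nle p by (intro frac_le sq powr_mono2) auto
      then show ?thesis using energy_density_self_nonneg[of p w x y] by linarith
    qed
  qed
  consider "0 < x $ k" "0 < y $ k" | "0 < x $ k" "y $ k \<le> 0" | "x $ k \<le> 0" "0 < y $ k"
    | "x $ k \<le> 0" "y $ k \<le> 0" by linarith
  then show ?thesis
  proof cases
    case 1
    have "\<bar>v x - v y\<bar>\<^sup>2 \<le> \<bar>w x - w y\<bar>\<^sup>2"
      using 1 by (intro power_mono) (auto simp: v_def half_pos_part_def)
    then have "energy_density p v v x y \<le> energy_density p w w x y"
      unfolding energy_density_self by (intro divide_right_mono) auto
    then show ?thesis using energy_density_self_nonneg[of p w x "reflection k y"] by linarith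
  next
    case 2
    then show ?thesis by (rule mixed)
  next
    case 3
    have "energy_density p w w y (reflection k x) = energy_density p w w x (reflection k y)"
      using norm_reflection_diff[of k x y]
      unfolding energy_density_self odd by (simp add: add.commute norm_minus_commute[of y])
    then show ?thesis
      using mixed[OF 3(2,1)] energy_density_commute[of p v v x y] energy_density_commute[of p w w x y] by simp
  next
    case 4
    then have "energy_density p v v x y = 0" by (simp add: energy_density_self v_def half_pos_part_def)
    then show ?thesis by (simp add: energy_density_self_nonneg)
  qed
qed

lemma finite_energy_half_pos_part:
  fixes w :: "real ^ 'n::finite \<Rightarrow> real"
  assumes p: "0 \<le> p" and odd: "\<And>x. w (reflection k x) = - w x"
    and wm[measurable]: "w \<in> borel_measurable borel" and w: "finite_energy p w"
  shows "finite_energy p (half_pos_part k w)"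
proof -
  let ?M = "lborel \<Otimes>\<^sub>M lborel :: ((real ^ 'n) \<times> (real ^ 'n)) measure"
  let ?v = "half_pos_part k w"
  have i1: "integrable ?M (\<lambda>(x, y). energy_density p w w x y)"
    using w by (simp only: finite_energy_def)
  then have "(\<lambda>(x, y). energy_density p w w x y) \<in> borel_measurable ?M" by auto
  from integrable_reflection_snd[OF this, of k] i1
  have i2: "integrable ?M (\<lambda>(x, y). energy_density p w w x (reflection k y))" by simp
  show ?thesis
    unfolding finite_energy_def
  proof (rule Bochner_Integration.integrable_bound[OF Bochner_Integration.integrable_add[OF i1 i2]])
    show "AE z in ?M. norm (case z of (x, y) \<Rightarrow> energy_density p ?v ?v x y)
      \<le> norm ((case z of (x, y) \<Rightarrow> energy_density p w w x y) +
          (case z of (x, y) \<Rightarrow> energy_density p w w x (reflection k y)))"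
      by (rule always_eventually)
        (auto simp: energy_density_self_nonneg intro!: order_trans[OF energy_density_half_pos_part_le[where w = w and k = k, OF p odd]])
  qed measurable
qed

text \<open>
  With \<open>a = w x\<close>, \<open>b = w y\<close>, \<open>\<alpha>\<close> the kernel and \<open>\<beta>\<close> the reflected kernel, the right side
  is the folded integrand. Split \<open>a\<close> and \<open>b\<close> into positive and negative parts: the products of positive
  parts form squares, and what remains is the interaction of negative with positive parts.
\<close>

lemma folded_product_ge:
  fixes a b \<alpha> \<beta> :: real
  assumes "0 \<le> \<alpha>" "0 \<le> \<beta>"
  shows "(max 0 (- a) * max 0 b + max 0 (- b) * max 0 a) * (\<alpha> - \<beta>) \<le>
    (a - b) * (max 0 a - max 0 b) * \<alpha> + (a + b) * (max 0 a + max 0 b) * \<beta>"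
proof -
  have sq: "0 \<le> c * c * \<alpha>" "0 \<le> c * c * \<beta>" for c :: real using assms by auto
  consider "0 \<le> a" "0 \<le> b" | "0 \<le> a" "b < 0" | "a < 0" "0 \<le> b" | "a < 0" "b < 0" by linarith
  then show ?thesis
  proof cases
    case 1
    then show ?thesis using sq(1)[of "a - b"] sq(2)[of "a + b"] by (simp add: max_absorb1 max_absorb2)
  next
    case 2
    then show ?thesis using sq[of a] by (simp add: max_def algebra_simps)
  next
    case 3
    then show ?thesis using sq[of b] by (simp add: max_def algebra_simps)
  next
    case 4
    then show ?thesis by (simp add: max_def)
  qed
qed

text \<open>
  With \<open>d\<close> and \<open>e\<close> the two distances, \<open>e\<^sup>2 - d\<^sup>2 = 4 x\<^sub>k y\<^sub>k\<close> and \<open>d \<le> e \<le> 2\<close> give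
  \<open>e - d \<ge> x\<^sub>k y\<^sub>k\<close>.
\<close>

lemma kernel_reflection_gap:
  assumes p: "1 \<le> p" and x: "x \<in> half_ball k" and y: "y \<in> half_ball k" and neq: "x \<noteq> y"
  shows "x $ k * y $ k / (2 * 2 powr p) \<le>
    1 / norm (x - y) powr p - 1 / norm (x - reflection k y) powr p"
proof -
  define d where "d = norm (x - y)"
  define e where "e = norm (x - reflection k y)"
  have pos: "0 < x $ k" "0 < y $ k" and n: "norm x < 1" "norm y < 1"
    using x y by (auto simp: half_ball_def half_space_def)
  have d0: "0 < d" using neq by (simp add: d_def)
  have sq: "e\<^sup>2 = d\<^sup>2 + 4 * (x $ k * y $ k)"
    unfolding d_def e_def by (simp add: norm_diff_reflection_sq)
  have de: "d \<le> e" unfolding d_def e_def using pos by (intro norm_diff_le_reflection) simp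
  have e2: "e \<le> 2"
    unfolding e_def using norm_triangle_ineq4[of x "reflection k y"] n by simp
  have "(e + d) * (e - d) = 4 * (x $ k * y $ k)"
    using sq by (simp add: power2_eq_square algebra_simps)
  moreover have "(e + d) * (e - d) \<le> 4 * (e - d)"
    using de e2 by (intro mult_right_mono) auto
  ultimately have "4 * (x $ k * y $ k) \<le> 4 * (e - d)" by (simp only:)
  then have gap: "x $ k * y $ k \<le> e - d" by simp
  have e0: "0 < e" using d0 de by linarith
  \<comment> \<open>Since \<open>e / d \<ge> 1\<close> and \<open>p \<ge> 1\<close>, the power \<open>p\<close> may be lowered to \<open>1\<close>.\<close>
  have ed: "1 \<le> e / d" using de d0 by simp
  have "x $ k * y $ k / 2 \<le> (e - d) / d"
    using gap de d0 e2 pos by (intro frac_le) auto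
  also have "\<dots> = (e / d) powr 1 - 1" using d0 e0 by (simp add: diff_divide_distrib)
  also have "\<dots> \<le> (e / d) powr p - 1" using powr_mono[OF p ed] by simp
  finally have r: "x $ k * y $ k / 2 \<le> (e / d) powr p - 1" .
  have "x $ k * y $ k / (2 * 2 powr p) = (1 / 2 powr p) * (x $ k * y $ k / 2)" by simp
  also have "\<dots> \<le> (1 / e powr p) * ((e / d) powr p - 1)"
    using e0 e2 p pos by (intro mult_mono r frac_le powr_mono2) auto
  also have "\<dots> = 1 / d powr p - 1 / e powr p"
    using d0 e0 by (simp add: powr_divide field_simps)
  finally show ?thesis by (simp add: d_def e_def)
qed

text \<open>
  Of the four copies of the integrand the one with both variables reflected vanishes, and
  the two mixed ones share the reflected kernel.
\<close>

lemma folded_energy_density_ge: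
  fixes w :: "real ^ 'n::finite \<Rightarrow> real" and k :: 'n
  assumes p: "0 \<le> p" and odd: "\<And>x. w (reflection k x) = - w x" and xy: "0 \<le> x $ k" "0 \<le> y $ k"
  defines "v \<equiv> half_pos_part k w"
  shows "(max 0 (- w x) * v y + max 0 (- w y) * v x) *
      (1 / norm (x - y) powr p - 1 / norm (x - reflection k y) powr p) \<le>
    energy_density p w v x y + energy_density p w v (reflection k x) y
      + energy_density p w v x (reflection k y) + energy_density p w v (reflection k x) (reflection k y)"
proof -
  let ?a = "w x" and ?b = "w y"
  let ?\<alpha> = "1 / norm (x - y) powr p" and ?\<beta> = "1 / norm (x - reflection k y) powr p"
  have v: "v x = max 0 ?a" "v y = max 0 ?b" "v (reflection k x) = 0" "v (reflection k y) = 0"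
    unfolding v_def using half_pos_part_of_odd[where w = w and k = k, OF odd] xy by auto
  have "energy_density p w v x y = (?a - ?b) * (max 0 ?a - max 0 ?b) * ?\<alpha>"
    "energy_density p w v (reflection k x) y = (?a + ?b) * max 0 ?b * ?\<beta>"
    "energy_density p w v x (reflection k y) = (?a + ?b) * max 0 ?a * ?\<beta>"
    "energy_density p w v (reflection k x) (reflection k y) = 0"
    unfolding energy_density_def v odd norm_reflection_diff by (simp_all add: algebra_simps add_divide_distrib diff_divide_distrib)
  then show ?thesis
    unfolding v using folded_product_ge[of ?\<alpha> ?\<beta> ?a ?b] by (simp add: distrib_left distrib_right add_divide_distrib)
qed

text \<open>
  After folding, the integrand is nonnegative everywhere, so it may be restricted to \<open>x \<in> K\<close>. There
  the negative part of \<open>w\<close> is at least \<open>\<mu>\<close> and the gap between the kernels is at least a multiple of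
  \<open>\<kappa> y\<^sub>k\<close>.
\<close>

lemma energy_form_half_pos_part_ge:
  fixes w :: "real ^ 'n::finite \<Rightarrow> real" and k :: 'n
  assumes p: "1 \<le> p" and odd: "\<And>x. w (reflection k x) = - w x"
    and wm[measurable]: "w \<in> borel_measurable borel" and w: "finite_energy p w"
  defines "v \<equiv> half_pos_part k w"
  assumes supp: "\<And>x. x \<notin> half_ball k \<Longrightarrow> v x = 0"
    and xv: "integrable lborel (\<lambda>x. x $ k * v x)"
    and K: "K \<in> sets borel" "emeasure lborel K < \<infinity>" "K \<subseteq> half_ball k" "\<And>x. x \<in> K \<Longrightarrow> \<kappa> \<le> x $ k"
    and \<mu>: "0 \<le> \<mu>" "0 \<le> \<kappa>" "\<And>x. x \<in> K \<Longrightarrow> w x \<le> - \<mu>"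
  shows "\<mu> * \<kappa> / (2 * 2 powr p) * measure lborel K * (\<integral>x. x $ k * v x \<partial>lborel) \<le> energy_form p w v"
proof -
  let ?M = "lborel \<Otimes>\<^sub>M lborel :: ((real ^ 'n) \<times> (real ^ 'n)) measure"
  let ?R = "reflection k" and ?\<sigma> = "half_weight k"
  let ?C = "\<mu> * \<kappa> / (2 * 2 powr p)"
  define S where "S x y = energy_density p w v x y + energy_density p w v (?R x) y
      + energy_density p w v x (?R y) + energy_density p w v (?R x) (?R y)" for x y
  have p0: "0 \<le> p" using p by simp
  have vm: "v \<in> borel_measurable borel" unfolding v_def by measurable
  have v: "finite_energy p v" unfolding v_def by (rule finite_energy_half_pos_part[where w = w and k = k, OF p0 odd wm w])
  have vnn: "0 \<le> v x" for x unfolding v_def by (rule half_pos_part_nonneg)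
  have C0: "0 \<le> ?C" using \<mu> by simp
  note i = integrable_energy_density[OF wm vm w v]
  have gap: "(max 0 (- w x) * v y + max 0 (- w y) * v x) *
      (1 / norm (x - y) powr p - 1 / norm (x - ?R y) powr p) \<le> S x y"
    if "0 \<le> x $ k" "0 \<le> y $ k" for x y
    unfolding S_def v_def by (rule folded_energy_density_ge[where w = w and k = k, OF p0 odd that])
  have Snn: "0 \<le> S x y" if xy: "0 \<le> x $ k" "0 \<le> y $ k" for x y
  proof (cases "x = y")
    case True
    have "max 0 (- w y) * v y = 0"
      using half_pos_part_of_odd(1)[where w = w and k = k, OF odd xy(2)] by (simp add: v_def max_def)
    then show ?thesis using gap[OF xy] unfolding True by (simp only: add_0_left mult_zero_left)
  next
    case False
    have "1 / norm (x - ?R y) powr p \<le> 1 / norm (x - y) powr p"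
      using norm_diff_le_reflection[of x k y] xy False p0
      by (intro divide_left_mono powr_mono2 mult_pos_pos) (auto simp: powr_gt_zero intro: le_less_trans[rotated])
    then have "0 \<le> (max 0 (- w x) * v y + max 0 (- w y) * v x) *
      (1 / norm (x - y) powr p - 1 / norm (x - ?R y) powr p)"
      by (intro mult_nonneg_nonneg add_nonneg_nonneg vnn) auto
    then show ?thesis using gap[OF xy] by linarith
  qed
  have pt: "indicator K x * (?C * (y $ k * v y)) \<le> ?\<sigma> x * ?\<sigma> y * S x y" for x y
  proof (cases "x \<in> K \<and> 0 < v y")
    case True
    then have x: "x \<in> half_ball k" and y: "y \<in> half_ball k" using K supp[of y] by auto
    then have pos: "0 < x $ k" "0 < y $ k" by (auto simp: half_ball_def half_space_def)
    have neq: "x \<noteq> y"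
      using True \<mu>(1) \<mu>(3)[of x] half_pos_part_of_odd(1)[where w = w and k = k, OF odd, of y] pos by (auto simp: v_def)
    let ?g = "1 / norm (x - y) powr p - 1 / norm (x - ?R y) powr p"
    have "\<kappa> * y $ k / (2 * 2 powr p) \<le> x $ k * y $ k / (2 * 2 powr p)"
      using K(4)[of x] True pos by (intro divide_right_mono mult_right_mono) auto
    also have "\<dots> \<le> ?g" by (rule kernel_reflection_gap[OF p x y neq])
    finally have g: "\<kappa> * y $ k / (2 * 2 powr p) \<le> ?g" .
    have g0: "0 \<le> \<kappa> * y $ k / (2 * 2 powr p)" using \<mu> pos by simp
    have wv: "w x * v y \<le> 0"
      using \<mu>(1) \<mu>(3)[of x] True by (intro mult_nonpos_nonneg) auto
    have "?C * (y $ k * v y) = \<mu> * v y * (\<kappa> * y $ k / (2 * 2 powr p))" by simp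
    also have "\<dots> \<le> (max 0 (- w x) * v y) * ?g"
      using \<mu>(1) \<mu>(3)[of x] True g g0 wv by (intro mult_mono mult_right_mono) auto
    also have "\<dots> \<le> (max 0 (- w x) * v y + max 0 (- w y) * v x) * ?g"
      using g g0 vnn by (intro mult_right_mono) auto
    also have "\<dots> \<le> S x y" using pos by (intro gap) auto
    finally show ?thesis using True pos by (simp add: half_weight_pos)
  next
    case False
    then have z: "indicator K x * (?C * (y $ k * v y)) = 0" using vnn[of y] by (auto simp: indicator_def)
    consider "x $ k < 0" | "y $ k < 0" | "0 \<le> x $ k" "0 \<le> y $ k" by linarith
    then have "0 \<le> ?\<sigma> x * ?\<sigma> y * S x y"
      by cases (auto simp: half_weight_neg half_weight_bounds intro!: mult_nonneg_nonneg Snn)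
    then show ?thesis by (simp only: z)
  qed
  have iK: "integrable lborel (indicator K :: _ \<Rightarrow> real)" using K by auto
  note iC = integrable_mult_right[OF xv, of ?C]
  have "?C * measure lborel K * (\<integral>x. x $ k * v x \<partial>lborel) =
      (\<integral>x. indicator K x \<partial>lborel) * (\<integral>y. ?C * (y $ k * v y) \<partial>lborel)"
    using K iC by simp
  also have "\<dots> = (\<integral>(x, y). indicator K x * (?C * (y $ k * v y)) \<partial>?M)"
    by (rule integrable_product_fun(2)[OF iK iC, symmetric])
  also have "\<dots> \<le> (\<integral>(x, y). ?\<sigma> x * ?\<sigma> y * S x y \<partial>?M)"
  proof (rule integral_mono)
    show "integrable ?M (\<lambda>(x, y). indicator K x * (?C * (y $ k * v y)))"
      by (rule integrable_product_fun(1)[OF iK iC])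
    show "integrable ?M (\<lambda>(x, y). ?\<sigma> x * ?\<sigma> y * S x y)"
      unfolding S_def by (rule integral_fold(1)[OF i])
    show "(case z of (x, y) \<Rightarrow> indicator K x * (?C * (y $ k * v y))) \<le> (case z of (x, y) \<Rightarrow> ?\<sigma> x * ?\<sigma> y * S x y)" for z
      using pt by (simp add: case_prod_unfold)
  qed
  also have "\<dots> = energy_form p w v"
    unfolding energy_form_def S_def by (rule integral_fold(2)[OF i, symmetric])
  finally show ?thesis .
qed

section \<open>Borel representatives\<close>

lemma borel_measurable_completion_AE_eq:
  fixes f g :: "'a \<Rightarrow> 'b::topological_space"
  assumes g: "g \<in> borel_measurable M" and ae: "AE x in M. f x = g x"
  shows "f \<in> borel_measurable (completion M)"
proof (rule measurableI)
  interpret completion: complete_measure "completion M" ..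
  fix A :: "'b set" assume A: "A \<in> sets borel"
  show "f -` A \<inter> space (completion M) \<in> sets (completion M)"
  proof (rule completion.in_sets_AE)
    show "g -` A \<inter> space (completion M) \<in> sets (completion M)"
      using measurable_sets[OF g A] by (simp add: sets_completionI_sets)
    show "AE x in completion M. x \<in> g -` A \<inter> space (completion M) \<longleftrightarrow> x \<in> f -` A \<inter> space (completion M)"
      using AE_completion[OF ae] by eventually_elim auto
  qed simp
qed simp

lemma AE_pair_of_AE:
  fixes P :: "'a::euclidean_space \<Rightarrow> bool"
  assumes "AE x in lborel. P x"
  shows "AE z in lborel \<Otimes>\<^sub>M lborel. P (fst z) \<and> P (snd z)"
proof -
  obtain N where N: "N \<in> null_sets lborel" "{x. \<not> P x} \<subseteq> N"
    using assms by (auto elim!: AE_E simp: null_sets_def)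
  have nN: "AE x in lborel. x \<notin> N" using N(1) by (rule AE_not_in)
  have Ns[measurable]: "N \<in> sets lborel" using N(1) by auto
  have "AE z in lborel \<Otimes>\<^sub>M (lborel :: 'a measure). fst z \<notin> N \<and> snd z \<notin> N"
  proof (rule lborel_pair.AE_pair_measure)
    show "{z \<in> space (lborel \<Otimes>\<^sub>M lborel). fst z \<notin> N \<and> snd z \<notin> N} \<in> sets (lborel \<Otimes>\<^sub>M (lborel :: 'a measure))"
      by measurable
    show "AE x in lborel. AE y in lborel. fst (x, y) \<notin> N \<and> snd (x, y) \<notin> N"
      using nN by eventually_elim (use nN in auto)
  qed
  then show ?thesis by eventually_elim (use N(2) in auto)
qed

text \<open>
  Carries integrals of the energy density from the completed Lebesgue measure on pairs to the
  product measure. The set of pairs where the functions differ is covered by two strips over null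
  sets.
\<close>

lemma energy_density_AE_cong:
  fixes u u' v v' :: "'a::euclidean_space \<Rightarrow> real"
  assumes um: "u' \<in> borel_measurable borel" and vm: "v \<in> borel_measurable borel"
    and ae: "AE x in lborel. u x = u' x" and ae': "AE x in lborel. v' x = v x"
  shows "(\<integral>(x, y). energy_density p u v' x y \<partial>lebesgue) = energy_form p u' v"
    and "integrable lebesgue (\<lambda>(x, y). energy_density p u v' x y) \<longleftrightarrow>
      integrable (lborel \<Otimes>\<^sub>M lborel) (\<lambda>(x, y). energy_density p u' v x y)"
proof -
  have m: "(\<lambda>(x, y). energy_density p u' v x y) \<in> borel_measurable (lborel :: ('a \<times> 'a) measure)"
    using energy_density_measurable[OF um vm] by (simp only: lborel_prod)
  have "AE z in lborel \<Otimes>\<^sub>M lborel. (u (fst z) = u' (fst z) \<and> v' (fst z) = v (fst z)) \<and>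
      (u (snd z) = u' (snd z) \<and> v' (snd z) = v (snd z))"
    using ae ae' by (intro AE_pair_of_AE) auto
  then have ae2: "AE z in lborel. (case z of (x, y) \<Rightarrow> energy_density p u v' x y) =
      (case z of (x, y) \<Rightarrow> energy_density p u' v x y)"
    unfolding lborel_prod by eventually_elim (auto simp: energy_density_def)
  have m': "(\<lambda>(x, y). energy_density p u v' x y) \<in> borel_measurable lebesgue"
    by (rule borel_measurable_completion_AE_eq[OF m ae2])
  have mc: "(\<lambda>(x, y). energy_density p u' v x y) \<in> borel_measurable lebesgue"
    using m by (rule measurable_completion)
  have "(\<integral>(x, y). energy_density p u v' x y \<partial>lebesgue) = (\<integral>(x, y). energy_density p u' v x y \<partial>lebesgue)"
    by (rule integral_cong_AE[OF m' mc AE_completion[OF ae2]])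
  also have "\<dots> = (\<integral>(x, y). energy_density p u' v x y \<partial>lborel)"
    by (rule integral_completion[OF m])
  finally show "(\<integral>(x, y). energy_density p u v' x y \<partial>lebesgue) = energy_form p u' v"
    by (simp only: energy_form_def lborel_prod)
  have "integrable lebesgue (\<lambda>(x, y). energy_density p u v' x y) \<longleftrightarrow>
      integrable lebesgue (\<lambda>(x, y). energy_density p u' v x y)"
    by (rule integrable_cong_AE[OF m' mc AE_completion[OF ae2]])
  also have "\<dots> \<longleftrightarrow> integrable lborel (\<lambda>(x, y). energy_density p u' v x y)"
    by (rule integrable_completion[OF m])
  finally show "integrable lebesgue (\<lambda>(x, y). energy_density p u v' x y) \<longleftrightarrow>
      integrable (lborel \<Otimes>\<^sub>M lborel) (\<lambda>(x, y). energy_density p u' v x y)"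
    by (simp only: lborel_prod)
qed

lemma frac_form_eq_energy_form:
  fixes u u' v :: "real ^ 'n::finite \<Rightarrow> real"
  assumes "u' \<in> borel_measurable borel" "v \<in> borel_measurable borel" and ae: "AE x in lborel. u x = u' x"
  shows "frac_form s u v = frac_const CARD('n) s / 2 * energy_form (real CARD('n) + 2 * s) u' v"
  using energy_density_AE_cong(1)[of u' v u v "real CARD('n) + 2 * s"] assms
  by (simp add: frac_form_def energy_density_def)

lemma Hs_energy_density:
  "u \<in> Hs s \<longleftrightarrow> u \<in> L2_fun \<and>
    integrable lebesgue (\<lambda>(x, y). energy_density (real CARD('n) + 2 * s) u u x (y :: real ^ 'n::finite))"
  by (simp add: Hs_def energy_density_self)

lemma Hs_imp_finite_energy:
  fixes u u' :: "real ^ 'n::finite \<Rightarrow> real"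
  assumes "u \<in> Hs s" "u' \<in> borel_measurable borel" "AE x in lborel. u x = u' x"
  shows "finite_energy (real CARD('n) + 2 * s) u'"
  using energy_density_AE_cong(2)[of u' u' u u "real CARD('n) + 2 * s"] assms
  by (simp add: Hs_energy_density finite_energy_def)

lemma HsI:
  fixes v :: "real ^ 'n::finite \<Rightarrow> real"
  assumes vm: "v \<in> borel_measurable borel" and "integrable lborel (\<lambda>x. (v x)\<^sup>2)"
    and "finite_energy (real CARD('n) + 2 * s) v"
  shows "v \<in> Hs s"
proof -
  have m: "v \<in> borel_measurable lborel" using vm by simp
  have "(\<lambda>x. (v x)\<^sup>2) \<in> borel_measurable lborel" using m by measurable
  then have "integrable lebesgue (\<lambda>x. (v x)\<^sup>2)"
    using assms(2) by (simp only: integrable_completion)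
  moreover have "v \<in> borel_measurable lebesgue" using m by (rule measurable_completion)
  ultimately show ?thesis
    using energy_density_AE_cong(2)[of v v v v "real CARD('n) + 2 * s"] assms
    by (simp add: Hs_energy_density L2_fun_def finite_energy_def)
qed

lemma antisymmetric_in_iff: "antisymmetric_in k u \<longleftrightarrow> (\<forall>x. u (reflection k x) = - u x)"
  by (simp add: antisymmetric_in_def reflection_def)

lemma AE_reflection:
  fixes P :: "real ^ 'n::finite \<Rightarrow> bool"
  assumes "AE x in lborel. P x"
  shows "AE x in lborel. P (reflection k x)"
  using AE_distrD[of "reflection k" lborel borel P, unfolded distr_reflection] assms by simp

text \<open>
  Take any Borel representative, raise it to \<open>g\<close> on the open half-space, extend it oddly and put
  \<open>0\<close> on the hyperplane. Each step changes it on a null set only, since the reflection preserves null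
  sets and an odd function vanishes on the hyperplane.
\<close>

lemma antisymmetric_borel_representative:
  fixes u g :: "real ^ 'n::finite \<Rightarrow> real"
  assumes um: "u \<in> borel_measurable lebesgue" and odd: "\<And>x. u (reflection k x) = - u x"
    and gm[measurable]: "g \<in> borel_measurable borel"
    and ge: "AE x in lborel. 0 < x $ k \<longrightarrow> g x \<le> u x"
  obtains u' where "u' \<in> borel_measurable borel" "\<And>x. u' (reflection k x) = - u' x"
    "\<And>x. 0 < x $ k \<Longrightarrow> g x \<le> u' x" "AE x in lborel. u x = u' x"
proof -
  obtain u0 where u0m: "u0 \<in> borel_measurable lborel" and ae: "AE x in lborel. u x = u0 x"
    using completion_ex_borel_measurable_real[OF um] by auto
  have [measurable]: "u0 \<in> borel_measurable borel" using u0m by simp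
  define u' where "u' x = (if 0 < x $ k then max (g x) (u0 x)
    else if x $ k < 0 then - max (g (reflection k x)) (u0 (reflection k x)) else 0)" for x
  show ?thesis
  proof
    show "u' \<in> borel_measurable borel" unfolding u'_def[abs_def] by measurable
    show "u' (reflection k x) = - u' x" for x by (auto simp: u'_def)
    show "g x \<le> u' x" if "0 < x $ k" for x using that by (simp add: u'_def)
    from ae have ae_refl: "AE x in lborel. u (reflection k x) = u0 (reflection k x)" by (rule AE_reflection)
    from ge have "AE x in lborel. 0 < reflection k x $ k \<longrightarrow> g (reflection k x) \<le> u (reflection k x)"
      by (rule AE_reflection)
    with ae ae_refl ge show "AE x in lborel. u x = u' x"
    proof eventually_elim
      case (elim x)
      show ?case
        using elim odd[of x] odd_on_hyperplane[of u k x, OF odd]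
        by (cases "x $ k" "0 :: real" rule: linorder_cases) (auto simp: u'_def max_def)
    qed
  qed
qed

lemma le_on_open_if_AE_le:
  fixes f g :: "'a::euclidean_space \<Rightarrow> real"
  assumes S: "open S" and f: "continuous_on S f" and g: "continuous_on S g"
    and ae: "AE x in lborel. x \<in> S \<longrightarrow> f x \<le> g x" and x: "x \<in> S"
  shows "f x \<le> g x"
proof (rule ccontr)
  let ?U = "{y \<in> S. g y < f y}"
  assume "\<not> f x \<le> g x"
  then have "?U \<noteq> {}" using x by auto
  moreover have "open ?U"
  proof -
    have "?U = S \<inter> (\<lambda>y. f y - g y) -` {0<..}" by auto
    then show ?thesis
      using continuous_on_open_vimage[OF S, of "\<lambda>y. f y - g y"] continuous_on_diff[OF f g]
      by (auto simp: Int_commute)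
  qed
  ultimately have "\<not> negligible ?U" by (simp add: open_not_negligible)
  moreover have "negligible ?U"
  proof -
    have "AE y in lebesgue. y \<notin> ?U" using AE_completion[OF ae] by eventually_elim auto
    then show ?thesis
      using \<open>open ?U\<close> by (simp add: negligible_iff_null_sets AE_iff_null_sets)
  qed
  ultimately show False by simp
qed

section \<open>Comparison with the profile\<close>

lemma open_half_ball: "open (half_ball (k :: 'n::finite))"
proof -
  have "open {x :: real ^ 'n. 0 < x $ k}"
    by (intro open_Collect_less continuous_intros)
  then show ?thesis unfolding half_ball_def half_space_def by (intro open_Int open_ball)
qed

lemma half_ball_borel [measurable]: "half_ball k \<in> sets borel"
  using open_half_ball by (rule borel_open)

lemma frac_const_pos: "0 < s \<Longrightarrow> s < 1 \<Longrightarrow> 0 < frac_const n s"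
  unfolding frac_const_def by (intro divide_pos_pos mult_pos_pos Gamma_real_pos) auto

text \<open>
  Where \<open>v\<close> vanishes the integrand does; elsewhere the bound on \<open>u'\<close> supplies the factor
  \<open>d x\<^sub>k\<close>.
\<close>

lemma reaction_integral_le:
  fixes u u' v c :: "real ^ 'n::finite \<Rightarrow> real"
  assumes c: "AE x in lebesgue_on (half_ball k). \<bar>c x\<bar> \<le> C" and C: "0 \<le> C"
    and vm: "v \<in> borel_measurable borel" and vnn: "\<And>x. 0 \<le> v x"
    and ae: "AE x in lborel. u x = u' x"
    and u'v: "\<And>x. 0 < v x \<Longrightarrow> \<bar>u' x\<bar> \<le> d * x $ k"
    and xv: "integrable lborel (\<lambda>x. x $ k * v x)"
    and supp: "\<And>x. x \<notin> half_ball k \<Longrightarrow> v x = 0" and d: "0 \<le> d"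
  shows "(\<integral>x. c x * u x * v x \<partial>lebesgue_on (half_ball k)) \<le> C * d * (\<integral>x. x $ k * v x \<partial>lborel)"
proof -
  let ?B = "half_ball k"
  have B: "?B \<in> sets lebesgue" by (simp add: sets_completionI_sets)
  have xvm: "(\<lambda>x. x $ k * v x) \<in> borel_measurable lborel" using xv by auto
  have ixv: "integrable lebesgue (\<lambda>x. x $ k * v x)"
    using xv xvm by (simp only: integrable_completion)
  have ind: "indicator ?B x * (C * d * (x $ k * v x)) = C * d * (x $ k * v x)" for x
    using supp[of x] by (auto simp: indicator_def)
  have "(\<integral>x. c x * u x * v x \<partial>lebesgue_on ?B) \<le> (\<integral>x. C * d * (x $ k * v x) \<partial>lebesgue_on ?B)"
  proof (rule integral_mono_AE')
    show "integrable (lebesgue_on ?B) (\<lambda>x. C * d * (x $ k * v x))"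
      using ixv B by (subst integrable_restrict_space) (auto simp: ind)
    have pos: "0 \<le> C * d * (x $ k * v x)" for x
    proof (cases "x \<in> ?B")
      case True
      then have "0 \<le> x $ k" by (simp add: half_ball_def half_space_def)
      then show ?thesis using C d vnn[of x] by simp
    qed (simp add: supp)
    show "AE x in lebesgue_on ?B. 0 \<le> C * d * (x $ k * v x)" using pos by simp
    have "AE x in lebesgue_on ?B. u x = u' x"
      using AE_completion[OF ae] B by (subst AE_restrict_space_iff) auto
    with c show "AE x in lebesgue_on ?B. c x * u x * v x \<le> C * d * (x $ k * v x)"
    proof eventually_elim
      case (elim x)
      show ?case
      proof (cases "0 < v x")
        case True
        have "\<bar>c x\<bar> * \<bar>u x\<bar> \<le> C * (d * x $ k)"
          using elim u'v[OF True] C by (intro mult_mono) auto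
        then have "c x * u x \<le> C * (d * x $ k)"
          by (metis abs_le_D1 abs_mult)
        from mult_right_mono[OF this vnn[of x]] show ?thesis by (simp add: mult_ac)
      next
        case False
        then have "v x = 0" using vnn[of x] by simp
        then show ?thesis by simp
      qed
    qed
  qed
  also have "\<dots> = (\<integral>x. C * d * (x $ k * v x) \<partial>lebesgue)"
    using B by (subst integral_restrict_space) (auto simp: ind)
  also have "\<dots> = C * d * (\<integral>x. x $ k * v x \<partial>lebesgue)" by (rule integral_mult_right_zero)
  also have "(\<integral>x. x $ k * v x \<partial>lebesgue) = (\<integral>x. x $ k * v x \<partial>lborel)"
    by (rule integral_completion[OF xvm])
  finally show ?thesis .
qed

lemma cball_subset_half_ball:
  fixes x :: "real ^ 'n::finite"
  assumes "x \<in> cball (axis k (1/2)) (1/4)"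
  shows "x \<in> half_ball k" and "1/4 \<le> x $ k"
proof -
  have n: "norm (x - axis k (1/2)) \<le> 1/4"
    using assms by (simp add: dist_norm norm_minus_commute)
  have "\<bar>(x - axis k (1/2)) $ k\<bar> \<le> 1/4"
    using component_le_norm_cart[of "x - axis k (1/2)" k] n by linarith
  then have "\<bar>x $ k - 1/2\<bar> \<le> 1/4" by (simp add: axis_def)
  then show xk: "1/4 \<le> x $ k" by linarith
  have "norm x \<le> norm (x - axis k (1/2)) + norm (axis k (1/2) :: real ^ 'n)"
    using norm_triangle_ineq[of "x - axis k (1/2)" "axis k (1/2)"] by simp
  also have "norm (axis k (1/2) :: real ^ 'n) = norm ((1/2) *\<^sub>R axis k 1 :: real ^ 'n)"
    by (rule arg_cong[where f = norm]) (simp add: vec_eq_iff axis_def)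
  also have "\<dots> = 1/2" by (simp add: norm_axis_1)
  also have "norm (x - axis k (1/2)) + 1/2 \<le> 1/4 + 1/2" using n by simp
  finally show "x \<in> half_ball k" using xk by (simp add: half_ball_def half_space_def)
qed

text \<open>
  The comparison argument: the test function is the positive part, on the half-space, of
  \<open>d \<psi> - u\<close>, and \<open>d\<close> is so small that the gain from the ball \<open>K\<close> outweighs the terms of order \<open>d\<close>.
\<close>

lemma weak_supersolution_ge_profile:
  fixes s :: real and k :: "'n::finite" and c u :: "real ^ 'n \<Rightarrow> real"
  assumes s: "0 < s" "s < 1"
    and c: "c \<in> Linf_on (half_ball k)"
    and u: "u \<in> Hs s" and cont: "continuous_on (ball 0 1) u"
    and odd: "antisymmetric_in k u"
    and super: "weak_supersolution s (half_ball k) c u"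
    and nonneg: "AE x in lebesgue. x \<in> half_space k \<longrightarrow> 0 \<le> u x"
    and pos: "\<forall>x \<in> half_ball k. 0 < u x"
  obtains d where "0 < d" "\<And>x. x \<in> half_ball k \<Longrightarrow> d * profile k x \<le> u x"
proof -
  define p where "p = real CARD('n) + 2 * s"
  have CARD1: "1 \<le> real CARD('n)" by (simp add: Suc_leI)
  have p1: "1 \<le> p" using s CARD1 unfolding p_def by linarith
  then have p0: "0 \<le> p" by simp
  \<comment> \<open>A compact part of the half ball on which \<open>u\<close> is bounded below by some \<open>m > 0\<close>.\<close>
  define K where "K = cball (axis k (1/2) :: real ^ 'n) (1/4)"
  have Kb: "K \<in> sets borel" by (simp add: K_def)
  have K: "emeasure lborel K < \<infinity>" "K \<subseteq> half_ball k" "\<And>x. x \<in> K \<Longrightarrow> 1/4 \<le> x $ k"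
    unfolding K_def using cball_subset_half_ball[where k = k] emeasure_lborel_cball_finite
    by blast+
  have Kpos: "0 < measure lborel K"
    unfolding K_def using content_cball_pos[of "1/4" "axis k (1/2) :: real ^ 'n"] by simp
  obtain x0 where x0: "x0 \<in> K" "\<And>x. x \<in> K \<Longrightarrow> u x0 \<le> u x"
  proof -
    have "continuous_on K u"
      using cont by (rule continuous_on_subset) (use K(2) in \<open>auto simp: half_ball_def\<close>)
    moreover have "compact K" "K \<noteq> {}" by (auto simp: K_def)
    ultimately show ?thesis using continuous_attains_inf[of K u] that by blast
  qed
  define m where "m = u x0"
  have m: "0 < m" using pos x0(1) K(2) by (auto simp: m_def)
  have u_odd: "u (reflection k x) = - u x" for x using odd by (simp add: antisymmetric_in_iff)
  have um: "u \<in> borel_measurable lebesgue" using u by (simp add: Hs_def L2_fun_def)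
  \<comment> \<open>The lower bound prescribed to the Borel representative: nonnegativity on the half-space and
    \<open>u' \<ge> m\<close> on \<open>K\<close> at once.\<close>
  define g where "g x = m * indicator K x" for x
  have gm: "g \<in> borel_measurable borel" unfolding g_def[abs_def] using Kb by measurable
  have "AE x in lborel. 0 < x $ k \<longrightarrow> g x \<le> u x"
    using nonneg unfolding AE_completion_iff
    by eventually_elim (auto simp: g_def indicator_def half_space_def m_def x0)
  then obtain u' where u'm: "u' \<in> borel_measurable borel" and u'odd: "\<And>x. u' (reflection k x) = - u' x"
    and u'ge: "\<And>x. 0 < x $ k \<Longrightarrow> g x \<le> u' x" and ae: "AE x in lborel. u x = u' x"
    using antisymmetric_borel_representative[OF um u_odd gm] by blast
  have u'nn: "0 \<le> u' x" if "0 < x $ k" for x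
  proof -
    have "0 \<le> g x" using m by (simp add: g_def)
    then show ?thesis using u'ge[OF that] by linarith
  qed
  have u'K: "m \<le> u' x" if "x \<in> K" for x
    using u'ge[of x] K(3)[OF that] that by (simp add: g_def)
  have u'e: "finite_energy p u'"
    unfolding p_def by (rule Hs_imp_finite_energy[OF u u'm ae])
  have \<psi>e: "finite_energy p (profile k)" by (rule finite_energy_profile[OF s p_def])
  obtain C0 where C0: "AE x in lebesgue_on (half_ball k). \<bar>c x\<bar> \<le> C0"
    using c by (auto simp: Linf_on_def)
  define C where "C = max 0 C0"
  have C: "0 \<le> C" "AE x in lebesgue_on (half_ball k). \<bar>c x\<bar> \<le> C"
    using C0 by (auto simp: C_def elim!: eventually_mono)
  define a where "a = frac_const CARD('n) s / 2"
  have a: "0 < a" using frac_const_pos[OF s] by (simp add: a_def)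
  define \<Lambda> where "\<Lambda> = 34 * (\<integral>z. min 1 ((norm (z :: real ^ 'n))\<^sup>2) / norm z powr p \<partial>lborel)"
  have \<Lambda>: "0 \<le> \<Lambda>" unfolding \<Lambda>_def by (intro mult_nonneg_nonneg integral_nonneg_AE) auto
  define \<gamma> where "\<gamma> = m / 2 * (1/4) / (2 * 2 powr p) * measure lborel K"
  have \<gamma>: "0 < \<gamma>" unfolding \<gamma>_def using m Kpos by simp
  define D where "D = a * \<Lambda> + C"
  have D: "0 \<le> D" unfolding D_def using a \<Lambda> C by simp
  \<comment> \<open>The first bound keeps \<open>d \<psi> \<le> m / 2\<close> on \<open>K\<close>, the second makes \<open>d D < a \<gamma>\<close>; the summand \<open>1\<close> only
    avoids division by zero.\<close>
  define d where "d = min (m / 2) (a * \<gamma> / (D + 1))"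
  have d: "0 < d" unfolding d_def using m a \<gamma> D by (auto intro!: divide_pos_pos mult_pos_pos)
  have dD: "d * D < a * \<gamma>"
  proof -
    have "d * D < d * (D + 1)" using d by simp
    also have "\<dots> \<le> a * \<gamma> / (D + 1) * (D + 1)"
      using D by (intro mult_right_mono) (auto simp: d_def)
    also have "\<dots> = a * \<gamma>" using D by simp
    finally show ?thesis .
  qed
  define w where "w x = d * profile k x - u' x" for x
  define v where "v = half_pos_part k w"
  have wm: "w \<in> borel_measurable borel"
    unfolding w_def[abs_def] using u'm profile_measurable by measurable
  have vm: "v \<in> borel_measurable borel" unfolding v_def using wm by (rule half_pos_part_measurable)
  have wodd: "w (reflection k x) = - w x" for x by (simp add: w_def u'odd profile_reflection)
  have we: "finite_energy p w"
    unfolding w_def[abs_def] by (rule finite_energy_diff[OF profile_measurable u'm \<psi>e u'e])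
  have ve: "finite_energy p v" unfolding v_def by (rule finite_energy_half_pos_part[where w = w and k = k, OF p0 wodd wm we])
  have vnn: "0 \<le> v x" for x unfolding v_def by (rule half_pos_part_nonneg)
  have vx: "x \<in> half_ball k \<and> v x \<le> d * profile k x \<and> u' x \<le> d * profile k x" if "v x \<noteq> 0" for x
  proof -
    have xk: "0 < x $ k" and w0: "0 < w x" and v_eq: "v x = w x"
      using that by (auto simp: v_def half_pos_part_def max_def split: if_splits)
    have "norm x < 1"
    proof (rule ccontr)
      assume "\<not> norm x < 1"
      then have "w x = - u' x" by (simp add: w_def profile_eq_0)
      then show False using w0 u'nn[OF xk] by simp
    qed
    then show ?thesis
      using xk w0 v_eq u'nn[OF xk] by (simp add: half_ball_def half_space_def w_def)
  qed
  have supp: "v x = 0" if "x \<notin> half_ball k" for x using vx that by blast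
  have v_le: "v x \<le> d * indicator (ball 0 1) x" for x
  proof (cases "v x = 0")
    case False
    have "profile k x \<le> 1" using abs_profile_le_1[of k x] by simp
    then have "d * profile k x \<le> d * 1" using d by (intro mult_left_mono) auto
    then show ?thesis using vx[OF False] by (simp add: half_ball_def)
  qed (use d in auto)
  have dom: "integrable lborel (\<lambda>x. C' * (d * indicator (ball 0 1) x))" for C' :: real
    by (intro integrable_mult_right integrable_real_indicator emeasure_lborel_ball_finite) simp
  have vi: "integrable lborel v"
    by (rule Bochner_Integration.integrable_bound[OF dom[of 1]])
      (use vm v_le vnn in \<open>auto intro!: always_eventually order_trans[OF v_le]\<close>)
  have absxv: "\<bar>x $ k * v x\<bar> \<le> d * indicator (ball 0 1) x" for x
  proof (cases "v x = 0")
    case False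
    have "\<bar>x $ k\<bar> \<le> 1" using vx[OF False] component_le_norm_cart[of x k] by (simp add: half_ball_def)
    then have "\<bar>x $ k\<bar> * v x \<le> 1 * v x" using vnn by (intro mult_right_mono) auto
    then show ?thesis using v_le[of x] vnn[of x] by (simp add: abs_mult)
  qed (use d in auto)
  have xv: "integrable lborel (\<lambda>x. x $ k * v x)"
    by (rule Bochner_Integration.integrable_bound[OF dom[of 1]])
      (use vm in \<open>auto intro!: always_eventually order_trans[OF absxv]\<close>)
  have v2: "integrable lborel (\<lambda>x. (v x)\<^sup>2)"
  proof (rule Bochner_Integration.integrable_bound[OF dom[of d]])
    have "(v x)\<^sup>2 \<le> d * (d * indicator (ball 0 1) x)" for x
      using power_mono[OF v_le vnn, of x 2] by (auto simp: power2_eq_square indicator_def)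
    then have "norm ((v x)\<^sup>2) \<le> norm (d * (d * indicator (ball 0 1) x))" for x
      by (metis abs_of_nonneg abs_ge_self order_trans real_norm_def zero_le_power2)
    then show "AE x in lborel. norm ((v x)\<^sup>2) \<le> norm (d * (d * indicator (ball 0 1) x))"
      by simp
  qed (use vm in measurable)
  have "v \<in> Hs s" by (rule HsI[OF vm v2 ve[unfolded p_def]])
  then have vH: "v \<in> Hs0 s (half_ball k)" using supp by (simp add: Hs0_def)
  define X where "X = (\<integral>x. x $ k * v x \<partial>lborel)"
  have Xnn: "0 \<le> x $ k * v x" for x
  proof (cases "v x = 0")
    case False
    then have "0 < x $ k" using vx by (simp add: half_ball_def half_space_def)
    then show ?thesis using vnn by simp
  qed simp
  have "0 \<le> frac_form s u v + (\<integral>x. c x * u x * v x \<partial>lebesgue_on (half_ball k))"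
    using super vH vnn by (simp add: weak_supersolution_def)
  also have "frac_form s u v = a * energy_form p u' v"
    unfolding a_def p_def by (rule frac_form_eq_energy_form[OF u'm vm ae])
  finally have test: "0 \<le> a * energy_form p u' v + (\<integral>x. c x * u x * v x \<partial>lebesgue_on (half_ball k))" .
  have e1: "energy_form p (profile k) v \<le> \<Lambda> * X"
    unfolding \<Lambda>_def X_def by (rule energy_form_profile_le[OF s p_def vi ve vnn supp xv])
  have e2: "\<gamma> * X \<le> energy_form p w v"
    unfolding \<gamma>_def X_def v_def
  proof (rule energy_form_half_pos_part_ge[where w = w and k = k, OF p1 wodd wm we _ _ Kb K])
    show "w x \<le> - (m / 2)" if "x \<in> K" for x
    proof -
      have "d \<le> m / 2" unfolding d_def by (rule min.cobounded1)
      moreover have "profile k x \<le> 1" "0 \<le> profile k x"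
        using abs_profile_le_1[of k x] K(3)[OF that] by (auto intro: profile_nonneg)
      ultimately have "d * profile k x \<le> (m / 2) * 1"
        using m by (intro mult_mono) auto
      then show ?thesis using u'K[OF that] by (simp add: w_def)
    qed
  qed (use supp xv m in \<open>auto simp: v_def\<close>)
  have e3: "energy_form p w v = d * energy_form p (profile k) v - energy_form p u' v"
    unfolding w_def[abs_def] by (rule energy_form_diff[OF profile_measurable u'm vm \<psi>e u'e ve])
  have e4: "(\<integral>x. c x * u x * v x \<partial>lebesgue_on (half_ball k)) \<le> C * d * X"
    unfolding X_def
  proof (rule reaction_integral_le[OF C(2,1) vm vnn ae _ xv supp])
    show "\<bar>u' x\<bar> \<le> d * x $ k" if "0 < v x" for x
    proof -
      have xk: "0 < x $ k" using vx[of x] that by (simp add: half_ball_def half_space_def)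
      have "d * profile k x \<le> d * x $ k" using profile_le[of x k] xk d by simp
      then show ?thesis using vx[of x] that u'nn[OF xk] by simp
    qed
  qed (use d in auto)
  have "energy_form p u' v \<le> d * (\<Lambda> * X) - \<gamma> * X"
    using e2 e3 mult_left_mono[OF e1 less_imp_le[OF d]] by linarith
  then have "a * energy_form p u' v \<le> a * (d * (\<Lambda> * X) - \<gamma> * X)"
    using a by (intro mult_left_mono) auto
  then have "0 \<le> a * (d * (\<Lambda> * X) - \<gamma> * X) + C * d * X" using test e4 by linarith
  also have "\<dots> = (d * D - a * \<gamma>) * X" by (simp add: D_def algebra_simps)
  finally have "X \<le> 0" using dD by (simp add: zero_le_mult_iff)
  moreover have "0 \<le> X" unfolding X_def using Xnn by (simp add: integral_nonneg)
  ultimately have "(\<integral>x. x $ k * v x \<partial>lborel) = 0" by (simp add: X_def)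
  then have "AE x in lborel. x $ k * v x = 0"
    using integral_nonneg_eq_0_iff_AE[OF xv] Xnn by simp
  with ae have ae_le: "AE x in lborel. x \<in> half_ball k \<longrightarrow> d * profile k x \<le> u x"
    by eventually_elim (auto simp: v_def half_pos_part_def half_ball_def half_space_def w_def max_def split: if_splits)
  show ?thesis
  proof
    fix x assume x: "x \<in> half_ball k"
    show "d * profile k x \<le> u x"
    proof (rule le_on_open_if_AE_le[OF open_half_ball _ _ ae_le x])
      show "continuous_on (half_ball k) (\<lambda>x. d * profile k x)"
        by (intro continuous_intros continuous_on_profile)
      show "continuous_on (half_ball k) u"
        using cont by (rule continuous_on_subset) (auto simp: half_ball_def)
    qed
  qed (rule d)
qed

text \<open>
  Along \<open>e\<^sub>1\<close> the profile is \<open>h (1 - h\<^sup>2)\<^sup>2 \<ge> h / 2\<close> for \<open>0 < h < 1 / 2\<close>.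
\<close>

theorem proposition1p5:
  fixes s :: real and k :: "'n::finite" and c u :: "real ^ 'n \<Rightarrow> real"
  assumes "0 < s" and "s < 1"
    and "c \<in> Linf_on (half_ball k)"
    and "u \<in> Hs s" and "continuous_on (ball 0 1) u"
    and "antisymmetric_in k u"
    and "weak_supersolution s (half_ball k) c u"
    and "AE x in lebesgue. x \<in> half_space k \<longrightarrow> 0 \<le> u x"
    and "\<forall>x \<in> half_ball k. 0 < u x"
  shows "Liminf (at 0) (\<lambda>h::real. ereal (u (h *\<^sub>R axis k 1) / h)) > 0"
proof -
  obtain d where d: "0 < d" and ge: "\<And>x. x \<in> half_ball k \<Longrightarrow> d * profile k x \<le> u x"
    by (rule weak_supersolution_ge_profile[OF assms]) (rule that)
  have ray: "d / 2 \<le> u (h *\<^sub>R axis k 1) / h" if h: "0 < h" "h < 1/2" for h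
  proof -
    let ?x = "h *\<^sub>R axis k 1 :: real ^ 'n"
    have n: "norm ?x = h" using h by (simp add: norm_axis_1)
    have xk: "?x $ k = h" by (simp add: axis_def)
    have "h\<^sup>2 \<le> (1/2)\<^sup>2" using h by (intro power_mono) auto
    then have h2: "3/4 \<le> 1 - h\<^sup>2" by (simp add: power2_eq_square)
    then have "(3/4)\<^sup>2 \<le> (1 - h\<^sup>2)\<^sup>2" by (intro power_mono) auto
    then have "1/2 \<le> (1 - h\<^sup>2)\<^sup>2" by (simp add: power2_eq_square)
    then have "1/2 \<le> bump ?x" using h2 by (simp add: bump_def n)
    then have "h * (1/2) \<le> profile k ?x" unfolding profile_def xk using h by (intro mult_left_mono) auto
    then have "d * (h * (1/2)) \<le> d * profile k ?x" using d by (intro mult_left_mono) auto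
    also have "\<dots> \<le> u ?x" using h n xk by (intro ge) (simp add: half_ball_def half_space_def)
    finally show ?thesis using h by (simp add: field_simps)
  qed
  have "ereal (d / 2) \<le> Liminf (at 0) (\<lambda>h::real. ereal (u (h *\<^sub>R axis k 1) / h))"
  proof (rule Liminf_bounded)
    show "\<forall>\<^sub>F h in at 0. ereal (d / 2) \<le> ereal (u (h *\<^sub>R axis k 1) / h)"
      unfolding eventually_at
    proof (intro exI[of _ "1/2"] conjI ballI impI)
      fix h :: real assume h: "h \<noteq> 0 \<and> dist h 0 < 1/2"
      show "ereal (d / 2) \<le> ereal (u (h *\<^sub>R axis k 1) / h)"
      proof (cases "0 < h")
        case True
        then show ?thesis using ray[of h] h by simp
      next
        case False
        \<comment> \<open>By antisymmetry the quotient is an even function of \<open>h\<close>.\<close>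
        have "reflection k ((- h) *\<^sub>R axis k 1) = h *\<^sub>R axis k 1"
          by (simp add: vec_eq_iff axis_def)
        then have "u (h *\<^sub>R axis k 1) = - u ((- h) *\<^sub>R axis k 1)"
          using assms(6) unfolding antisymmetric_in_iff by metis
        then show ?thesis using ray[of "- h"] False h by simp
      qed
    qed simp
  qed
  moreover have "0 < ereal (d / 2)" using d by simp
  ultimately show ?thesis by (rule less_le_trans[rotated])
qed

end
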